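(* Let $0<\varepsilon<1$ and $0<\sigma_0<2$. If $C>0$ is large enough, then with $b=C\log t$, as $t\to+\infty$, \[ U(t)=\frac{1}{2\pi i}\int_{-b-i\sigma_0}^{\,b-i\sigma_0} e^{ix\vartheta'(t)+i\frac{x^2}{2}\vartheta''(t)}\,\zeta\bigl(\tfrac12+i(t+x)\bigr)\,\frac{\pi}{2\sinh\frac{\pi x}{2}}\,dx+O\bigl(t^{-\frac74+\varepsilon}\bigr), \] the integral being over the horizontal segment from $-b-i\sigma_0$ to $b-i\sigma_0$.
   Context: $\vartheta$ is the Riemann–Siegel theta function: the holomorphic function on $\mathbb C\setminus(\{iy:y\ge\frac12\}\cup\{iy:y\le-\frac12\})$ with $\vartheta(0)=0$ and $e^{i\vartheta(t)}=\pi^{-it/2}\sqrt{\Gamma(\frac14+\frac{it}{2})/\Gamma(\frac14-\frac{it}{2})}$. $\zeta$ is the Riemann zeta function. For real $t$, \[ U(t)=\frac{1}{2\pi i}\int_{-i\sigma-\infty}^{-i\sigma+\infty} e^{i\vartheta(t+x)-i\vartheta(t)}\,\zeta\bigl(\tfrac12+i(t+x)\bigr)\,\frac{\pi}{2\sinh\frac{\pi x}{2}}\,dx,\qquad 0<\sigma<\tfrac12, \] which is independent of $\sigma\in(0,\frac12)$. *)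

theory Defs
  imports "HOL-Complex_Analysis.Complex_Analysis" "HOL-Library.Landau_Symbols"
begin

definition riemann_zeta :: "complex \<Rightarrow> complex" where
  "riemann_zeta s = (THE z. \<exists>f. f holomorphic_on (- {1}) \<and>
      (\<forall>w. 1 < Re w \<longrightarrow> f w = (\<Sum>n. 1 / (of_nat (Suc n)) powr w)) \<and> f s = z)"

definition theta_dom :: "complex set" where
  "theta_dom = - ({z. Re z = 0 \<and> Im z \<ge> 1/2} \<union> {z. Re z = 0 \<and> Im z \<le> -1/2})"

text \<open>Riemann--Siegel theta: the holomorphic function on theta_dom with value 0 at 0
  and exp(i theta(t)) = pi^(-it/2) sqrt(Gamma(1/4+it/2)/Gamma(1/4-it/2)),
  i.e. exp(2 i theta(t)) = pi^(-it) Gamma(1/4+it/2)/Gamma(1/4-it/2).\<close>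
definition rs_theta :: "complex \<Rightarrow> complex" where
  "rs_theta z = (THE w. \<exists>f. f holomorphic_on theta_dom \<and> f 0 = 0 \<and>
      (\<forall>t\<in>theta_dom. exp (2 * \<i> * f t) =
          (of_real pi) powr (- \<i> * t) * Gamma (1/4 + \<i> * t / 2) / Gamma (1/4 - \<i> * t / 2)) \<and>
      f z = w)"

definition U_integrand :: "real \<Rightarrow> complex \<Rightarrow> complex" where
  "U_integrand t x = exp (\<i> * rs_theta (of_real t + x) - \<i> * rs_theta (of_real t)) *
      riemann_zeta (1/2 + \<i> * (of_real t + x)) * (of_real pi / (2 * sinh (of_real pi * x / 2)))"

text \<open>U(t), taken along the horizontal line Im x = -1/4 (sigma = 1/4; the value is
  independent of sigma in (0,1/2)).\<close>
definition U :: "real \<Rightarrow> complex" where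
  "U t = (1 / (2 * of_real pi * \<i>)) *
      integral UNIV (\<lambda>u::real. U_integrand t (of_real u - \<i> * of_real (1/4)))"

end

theory Submission
  imports Defs "HOL-Real_Asymp.Real_Asymp"
begin

text \<open>
  Write the integrand of \<open>U(t)\<close> as the quadratic integrand times \<open>exp(i R)\<close>, where \<open>R\<close> is the
  second-order Taylor remainder of \<open>\<vartheta>\<close> at \<open>t\<close>; the polygamma series give \<open>\<vartheta>'''(z) = O(t^(\<eta>-2))\<close>
  near \<open>t\<close>, so \<open>R = O(t^(\<eta>'-2))\<close> for \<open>|x| = O(log t)\<close>. On the line \<open>Im x = -\<sigma>\<close> the quadratic
  exponential has size \<open>exp(\<sigma> \<vartheta>'(t)) = O(t^(\<sigma>/2))\<close>, and zeta is bounded there once \<open>\<sigma> > 1/2\<close>. With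
  \<open>\<sigma> = 1/2 + \<epsilon>/2\<close> the replacement therefore costs \<open>O(t^(1/4 - 2 + \<epsilon>))\<close>. Truncating the line
  \<open>Im x = -1/4\<close> at \<open>|Re x| = C log t\<close> and moving the two integrals between horizontal lines costs only
  \<open>O(t^(2-C))\<close>, because of the exponential decay of \<open>1/sinh\<close>.
\<close>

section \<open>Analytic continuation and bounds of the zeta function\<close>

text \<open>Truncation has to precede the shift. On the full line, moving past Im x = -1/2 would
  meet t + x = -\<i>/2, where zeta has its pole and a slit of the theta domain begins; once Re x >
  -t, both are out of reach. On the tails and the vertical sides every power of t is paid for by the
  choice of C, so linear bounds for zeta and for exp(\<i> theta) suffice there. The replacement of
  theta by its quadratic polynomial enjoys no such saving: the factor t^(\<sigma>/2) asks for small
  \<sigma>, a bounded zeta asks for \<sigma> > 1/2, and 1/4 - 2 = -7/4 is what remains in the limit.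
  The loss \<epsilon> is spent on \<sigma> - 1/2, on a lossy polygamma estimate and on powers of log
  t. Zeta and theta are definite descriptions, so explicit functions meeting these descriptions are
  built first. No Stirling expansion is used: on Im z = -1/4 a comparison of Gamma products is
  enough, and on Im z = -1/2 the reflection formula is exact.\<close>

lemma holomorphic_on_suminf_comparison:
  fixes f :: "nat \<Rightarrow> complex \<Rightarrow> complex"
  assumes S: "open S" and holo: "\<And>n. f n holomorphic_on S"
    and dom: "\<And>x. x \<in> S \<Longrightarrow> \<exists>d>0. \<exists>h. summable h \<and> (\<forall>n. \<forall>y\<in>ball x d \<inter> S. norm (f n y) \<le> h n)"
  shows "(\<lambda>x. \<Sum>n. f n x) holomorphic_on S"
proof -
  have to_g: "\<exists>d h. 0 < d \<and> summable h \<and> range h \<subseteq> \<real>\<^sub>\<ge>\<^sub>0 \<and>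
      (\<forall>\<^sub>F n in sequentially. \<forall>y\<in>ball x d \<inter> S. cmod (f n y) \<le> cmod (h n))" if x: "x \<in> S" for x
  proof -
    obtain d h where d: "d > 0" and h: "summable h"
      and fh: "\<And>n y. y \<in> ball x d \<inter> S \<Longrightarrow> norm (f n y) \<le> h n"
      using dom[OF x] by blast
    have h0: "h n \<ge> 0" for n
      using order_trans[OF norm_ge_zero fh[of x n]] x d by simp
    show ?thesis
    proof (intro exI conjI)
      show "summable (\<lambda>n. complex_of_real (h n))"
        using h by (rule summable_of_real)
      show "range (\<lambda>n. complex_of_real (h n)) \<subseteq> \<real>\<^sub>\<ge>\<^sub>0"
        using h0 by (auto simp: nonneg_Reals_of_real_iff)
      show "\<forall>\<^sub>F n in sequentially. \<forall>y\<in>ball x d \<inter> S. cmod (f n y) \<le> cmod (complex_of_real (h n))"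
        using fh h0 by (intro always_eventually) simp
    qed (rule d)
  qed
  obtain g where g: "\<forall>x\<in>S. (\<lambda>n. f n x) sums g x \<and> g field_differentiable (at x)"
    using series_differentiable_comparison_complex[OF S _ to_g]
      holomorphic_on_imp_differentiable_at[OF holo S] by metis
  have "g holomorphic_on S"
    using g by (simp add: holomorphic_onI field_differentiable_at_within)
  then show "(\<lambda>x. \<Sum>n. f n x) holomorphic_on S"
    by (rule holomorphic_transform) (use g sums_unique in auto)
qed

lemma summable_Suc_powr: "a < -1 \<Longrightarrow> summable (\<lambda>n. real (Suc n) powr a)"
  using summable_real_powr_iff[of a] summable_Suc_iff[of "\<lambda>n. real n powr a"] by simp

lemma norm_of_nat_powr: "norm (of_nat (Suc n) powr w :: complex) = real (Suc n) powr Re w"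
  using norm_powr_real_powr[of "of_nat (Suc n)" w] by (metis Re_complex_of_real Reals_of_nat of_nat_0_le_iff of_real_of_nat_eq)

text \<open>Remainder of the binomial expansion of \<open>(m + 1)^w\<close> at \<open>m = Suc n\<close>. Summing over \<open>m\<close> telescopes the
  first two terms and turns the others into zeta values at \<open>j - w\<close>, while the remainder sum converges
  for \<open>Re w < K\<close>: this continues \<open>-w \<zeta>(1 - w)\<close> one unit strip at a time.\<close>
definition powr_rem :: "nat \<Rightarrow> nat \<Rightarrow> complex \<Rightarrow> complex" where
  "powr_rem K n w = of_nat (Suc (Suc n)) powr w
     - (\<Sum>j\<le>K. (w gchoose j) * of_nat (Suc n) powr (w - of_nat j))"

lemma gbinomial_Suc_right: "of_nat (Suc i) * (w gchoose Suc i) = (w - of_nat i) * (w gchoose i)"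
  for w :: complex
  using gbinomial_absorption[of i w] gbinomial_absorb_comp[of w i] by simp

text \<open>Taylor expansion of x^w on the unit segment from n + 1 to n + 2, where all powers of the
  increment are 1. The hypothesis on Re w makes the next derivative largest at the left end. The
  factor \<open>Suc K\<close> is the quotient of \<open>fact (Suc K)\<close>, from that derivative,
  by \<open>fact K\<close>, from the form of the remainder in \<open>complex_Taylor\<close>.\<close>

lemma norm_powr_rem_le:
  assumes w: "Re w \<le> real (Suc K)"
  shows "norm (powr_rem K n w) \<le> real (Suc K) * norm (w gchoose Suc K) * real (Suc n) powr (Re w - real (Suc K))"
proof -
  define S where "S = closed_segment (of_real (real (Suc n))) (of_real (real (Suc (Suc n))) :: complex)"
  define f where "f = (\<lambda>i x. fact i * (w gchoose i) * x powr (w - of_nat i))"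
  have Sreal: "\<exists>r. x = complex_of_real r \<and> real (Suc n) \<le> r" if "x \<in> S" for x
    using that unfolding S_def closed_segment_of_real closed_segment_eq_real_ivl by auto
  have coeff: "fact i * (w gchoose i) * (w - of_nat i) = fact (Suc i) * (w gchoose Suc i)" for i
  proof -
    have "fact (Suc i) * (w gchoose Suc i) = fact i * (of_nat (Suc i) * (w gchoose Suc i))"
      by (simp only: fact_Suc of_nat_mult) (simp add: algebra_simps)
    then show ?thesis unfolding gbinomial_Suc_right by simp
  qed
  have "cmod (f 0 (of_real (real (Suc (Suc n)))) - (\<Sum>i\<le>K. f i (of_real (real (Suc n)))
          * (of_real (real (Suc (Suc n))) - of_real (real (Suc n))) ^ i / fact i))
        \<le> (fact (Suc K) * norm (w gchoose Suc K) * real (Suc n) powr (Re w - real (Suc K)))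
          * cmod (of_real (real (Suc (Suc n))) - of_real (real (Suc n))) ^ Suc K / fact K"
  proof (rule complex_Taylor)
    show "convex S" unfolding S_def by simp
    show "of_real (real (Suc n)) \<in> S" "of_real (real (Suc (Suc n))) \<in> S" unfolding S_def by auto
    show "(f i has_field_derivative f (Suc i) x) (at x within S)" if x: "x \<in> S" for i x
    proof -
      obtain r where r: "x = complex_of_real r" "real (Suc n) \<le> r" using Sreal[OF x] by blast
      have "x \<notin> \<real>\<^sub>\<le>\<^sub>0" using r by (auto simp: complex_nonpos_Reals_iff)
      then have "(f i has_field_derivative fact i * (w gchoose i) * ((w - of_nat i) * x powr (w - of_nat i - 1))) (at x within S)"
        unfolding f_def by (auto intro!: derivative_eq_intros DERIV_subset[OF has_field_derivative_powr])
      also have "fact i * (w gchoose i) * ((w - of_nat i) * x powr (w - of_nat i - 1)) = f (Suc i) x"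
        unfolding f_def coeff[symmetric] by (simp add: algebra_simps)
      finally show ?thesis .
    qed
    show "cmod (f (Suc K) x) \<le> fact (Suc K) * norm (w gchoose Suc K) * real (Suc n) powr (Re w - real (Suc K))"
      if x: "x \<in> S" for x
    proof -
      obtain r where r: "x = complex_of_real r" "real (Suc n) \<le> r" using Sreal[OF x] by blast
      have "cmod (x powr (w - of_nat (Suc K))) = r powr (Re w - real (Suc K))"
        using r norm_powr_real_powr[of x "w - of_nat (Suc K)"] by simp
      also have "\<dots> \<le> real (Suc n) powr (Re w - real (Suc K))"
        using r w by (intro powr_mono2') auto
      finally show ?thesis unfolding f_def
        by (simp add: norm_mult mult_left_mono del: fact_Suc of_nat_Suc)
    qed
  qed
  moreover have "complex_of_real (real (Suc (Suc n))) - of_real (real (Suc n)) = 1" by simp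
  ultimately have "cmod (f 0 (of_nat (Suc (Suc n))) - (\<Sum>i\<le>K. f i (of_nat (Suc n)) / fact i))
        \<le> fact (Suc K) * norm (w gchoose Suc K) * real (Suc n) powr (Re w - real (Suc K)) / fact K"
    by (simp only: power_one norm_one mult_1_right of_real_of_nat_eq)
  moreover have "f 0 (of_nat (Suc (Suc n))) - (\<Sum>i\<le>K. f i (of_nat (Suc n)) / fact i) = powr_rem K n w"
    unfolding f_def powr_rem_def by simp
  moreover have "fact (Suc K) * a * b / fact K = real (Suc K) * a * b" for a b :: real by simp
  ultimately show ?thesis by (simp only:)
qed

lemma holomorphic_gbinomial [holomorphic_intros]:
  "f holomorphic_on S \<Longrightarrow> (\<lambda>w. f w gchoose k) holomorphic_on S" for f :: "complex \<Rightarrow> complex"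
  unfolding gbinomial_prod_rev by (intro holomorphic_intros) auto

lemma holomorphic_powr_rem: "powr_rem K n holomorphic_on S"
  unfolding powr_rem_def [abs_def] by (intro holomorphic_intros)

lemma holomorphic_powr_rem_sum: "(\<lambda>w. \<Sum>n. powr_rem K n w) holomorphic_on {w. Re w < real K}"
proof -
  have op: "open {w. Re w < real K}" by (rule open_halfspace_Re_lt)
  have dom: "\<exists>d>0. \<exists>h. summable h \<and> (\<forall>n. \<forall>y\<in>ball x d \<inter> {w. Re w < real K}. norm (powr_rem K n y) \<le> h n)"
    if x: "x \<in> {w. Re w < real K}" for x
  proof -
    \<comment> \<open>Half the distance to the boundary: Re x + d stays below K, so the majorant has
      exponent below -1.\<close>
    define d where "d = (real K - Re x) / 2"
    have d: "d > 0" using x by (simp add: d_def)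
    have "continuous_on (cball x d) (\<lambda>w. norm (w gchoose Suc K))"
      by (intro continuous_on_norm holomorphic_on_imp_continuous_on holomorphic_intros)
    then have "bounded ((\<lambda>w. norm (w gchoose Suc K)) ` cball x d)"
      by (intro compact_imp_bounded compact_continuous_image) auto
    then obtain B where B: "\<And>w. w \<in> cball x d \<Longrightarrow> norm (w gchoose Suc K) \<le> B"
      unfolding bounded_iff by fastforce
    have "norm (powr_rem K n y) \<le> real (Suc K) * B * real (Suc n) powr (Re x + d - real (Suc K))"
      if y: "y \<in> ball x d \<inter> {w. Re w < real K}" for n y
    proof -
      have "Re y - Re x \<le> norm (y - x)" using complex_Re_le_cmod[of "y - x"] by simp
      then have "Re y \<le> Re x + d" using y by (simp add: dist_norm norm_minus_commute)
      then have "real (Suc n) powr (Re y - real (Suc K)) \<le> real (Suc n) powr (Re x + d - real (Suc K))"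
        by (intro powr_mono) auto
      moreover have "norm (y gchoose Suc K) \<le> B" using y by (intro B) auto
      moreover have "0 \<le> B" using order_trans[OF norm_ge_zero calculation(2)] .
      ultimately have "real (Suc K) * norm (y gchoose Suc K) * real (Suc n) powr (Re y - real (Suc K))
          \<le> real (Suc K) * B * real (Suc n) powr (Re x + d - real (Suc K))"
        by (intro mult_mono mult_nonneg_nonneg) auto
      with norm_powr_rem_le[of y K n] y show ?thesis by (intro order_trans[OF norm_powr_rem_le]) auto
    qed
    moreover have "summable (\<lambda>n. real (Suc K) * B * real (Suc n) powr (Re x + d - real (Suc K)))"
      using x by (intro summable_mult summable_Suc_powr) (simp add: d_def field_simps)
    ultimately show ?thesis using d by blast
  qed
  show "(\<lambda>w. \<Sum>n. powr_rem K n w) holomorphic_on {w. Re w < real K}"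
    by (rule holomorphic_on_suminf_comparison[OF op holomorphic_powr_rem dom])
qed

text \<open>This is \<open>(s - 1) \<zeta>(s)\<close> in the variable \<open>w = 1 - s\<close>; the factor removes the pole, so that the
  continuation is entire.\<close>
definition zeta_sum :: "complex \<Rightarrow> complex" where
  "zeta_sum w = - w * (\<Sum>n. of_nat (Suc n) powr (w - 1))"

lemma summable_of_nat_powr: "Re w < -1 \<Longrightarrow> summable (\<lambda>n. of_nat (Suc n) powr w :: complex)"
  by (rule summable_norm_cancel) (simp only: norm_of_nat_powr summable_Suc_powr)

lemma holomorphic_zeta_sum: "zeta_sum holomorphic_on {w. Re w < 0}"
proof -
  have op: "open {w. Re w < 0}" by (rule open_halfspace_Re_lt)
  have dom: "\<exists>d>0. \<exists>h. summable h \<and> (\<forall>n. \<forall>y\<in>ball x d \<inter> {w. Re w < 0}. norm (of_nat (Suc n) powr (y - 1) :: complex) \<le> h n)"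
    if x: "x \<in> {w. Re w < 0}" for x
  proof -
    define d where "d = - Re x / 2"
    have "norm (of_nat (Suc n) powr (y - 1) :: complex) \<le> real (Suc n) powr (Re x + d - 1)"
      if y: "y \<in> ball x d \<inter> {w. Re w < 0}" for n y
    proof -
      have "Re y - Re x \<le> norm (y - x)" using complex_Re_le_cmod[of "y - x"] by simp
      then have "Re y \<le> Re x + d" using y by (simp add: dist_norm norm_minus_commute)
      then show ?thesis unfolding norm_of_nat_powr by (intro powr_mono) auto
    qed
    moreover have "summable (\<lambda>n. real (Suc n) powr (Re x + d - 1))"
      using x by (intro summable_Suc_powr) (simp add: d_def field_simps)
    moreover have "d > 0" using x by (simp add: d_def)
    ultimately show ?thesis by blast
  qed
  have "(\<lambda>w. \<Sum>n. of_nat (Suc n) powr (w - 1) :: complex) holomorphic_on {w. Re w < 0}"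
    by (rule holomorphic_on_suminf_comparison[OF op _ dom]) (auto intro!: holomorphic_intros)
  then show ?thesis unfolding zeta_sum_def [abs_def] by (intro holomorphic_intros)
qed

text \<open>In this half-plane each piece of \<open>powr_rem\<close> can be summed separately. The
  difference of the two leading powers telescopes to -1. In the others, absorbing w - i from the
  binomial coefficient supplies exactly the factor that turns a power sum into
  \<open>zeta_sum\<close>. The term i = 0 is \<open>zeta_sum w\<close> itself, so the identity can
  be solved for it.\<close>

lemma suminf_powr_rem:
  assumes w: "Re w < 0"
  shows "(\<Sum>n. powr_rem K n w) = -1 + (\<Sum>i<K. (w gchoose i) / of_nat (Suc i) * zeta_sum (w - of_nat i))"
proof -
  define Z where "Z = (\<lambda>v. \<Sum>n. of_nat (Suc n) powr v :: complex)"
  have "(\<lambda>n. of_nat (Suc (Suc n)) powr w - of_nat (Suc n) powr w) sums (0 - of_nat (Suc 0) powr w)"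
  proof (rule telescope_sums)
    have "(\<lambda>n. real (Suc n) powr Re w) \<longlonglongrightarrow> 0"
      using w by (intro tendsto_neg_powr filterlim_compose[OF filterlim_real_sequentially filterlim_Suc])
    then show "(\<lambda>n. of_nat (Suc n) powr w) \<longlonglongrightarrow> 0"
      by (subst tendsto_norm_zero_iff[symmetric]) (simp only: norm_of_nat_powr)
  qed
  moreover have "(\<lambda>n. \<Sum>i<K. (w gchoose Suc i) * of_nat (Suc n) powr (w - of_nat (Suc i)))
      sums (\<Sum>i<K. (w gchoose Suc i) * Z (w - of_nat (Suc i)))"
    unfolding Z_def using w
    by (intro sums_sum sums_mult summable_sums summable_of_nat_powr) auto
  ultimately have "(\<lambda>n. of_nat (Suc (Suc n)) powr w - of_nat (Suc n) powr w
        - (\<Sum>i<K. (w gchoose Suc i) * of_nat (Suc n) powr (w - of_nat (Suc i))))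
      sums (0 - of_nat (Suc 0) powr w - (\<Sum>i<K. (w gchoose Suc i) * Z (w - of_nat (Suc i))))"
    by (rule sums_diff)
  moreover have "of_nat (Suc (Suc n)) powr w - of_nat (Suc n) powr w
        - (\<Sum>i<K. (w gchoose Suc i) * of_nat (Suc n) powr (w - of_nat (Suc i))) = powr_rem K n w" for n
    unfolding powr_rem_def lessThan_Suc_atMost[symmetric] sum.lessThan_Suc_shift by (simp del: of_nat_Suc)
  moreover have "(w gchoose Suc i) * Z (w - of_nat (Suc i))
      = - ((w gchoose i) / of_nat (Suc i) * zeta_sum (w - of_nat i))" for i
  proof -
    have "(w gchoose Suc i) = (w - of_nat i) * (w gchoose i) / of_nat (Suc i)"
      using gbinomial_Suc_right[of i w] by (simp add: field_simps del: of_nat_Suc)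
    moreover have "w - of_nat (Suc i) = w - of_nat i - 1" by simp
    moreover have "a * b / c * z = - (b / c * (- a * z))" for a b c z :: complex by simp
    ultimately show ?thesis unfolding zeta_sum_def Z_def by (simp only:)
  qed
  ultimately have "(\<lambda>n. powr_rem K n w) sums (- 1 + (\<Sum>i<K. (w gchoose i) / of_nat (Suc i) * zeta_sum (w - of_nat i)))"
    by (simp add: sum_negf del: of_nat_Suc) (simp add: powr_one_eq_one)
  then show ?thesis by (simp add: sums_iff)
qed

text \<open>Solve \<open>suminf_powr_rem\<close> with \<open>Suc K\<close> for its term i = 0. All
  other terms take \<open>zeta_sum\<close> at points at least one unit further left, where the
  previous continuation is available, and the remainder series is holomorphic in the enlarged
  half-plane.\<close>

lemma zeta_sum_continuation:
  "\<exists>G. G holomorphic_on {w. Re w < real K} \<and> (\<forall>w. Re w < 0 \<longrightarrow> G w = zeta_sum w)"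
proof (induction K)
  case 0
  then show ?case using holomorphic_zeta_sum by auto
next
  case (Suc K)
  then obtain G where G: "G holomorphic_on {w. Re w < real K}" "\<And>w. Re w < 0 \<Longrightarrow> G w = zeta_sum w"
    by blast
  define H where "H = (\<lambda>w. 1 + (\<Sum>n. powr_rem (Suc K) n w)
    - (\<Sum>i<K. (w gchoose Suc i) / of_nat (Suc (Suc i)) * G (w - of_nat (Suc i))))"
  have "(\<lambda>w. G (w - of_nat (Suc i))) holomorphic_on {w. Re w < real (Suc K)}" for i
    using holomorphic_on_compose_gen[OF _ G(1), of "\<lambda>w. w - of_nat (Suc i)" "{w. Re w < real (Suc K)}"]
    by (force simp: o_def intro!: holomorphic_intros)
  then have "H holomorphic_on {w. Re w < real (Suc K)}"
    unfolding H_def by (intro holomorphic_intros holomorphic_powr_rem_sum) (auto simp del: of_nat_Suc)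
  moreover have "H w = zeta_sum w" if w: "Re w < 0" for w
    unfolding H_def suminf_powr_rem[OF w] sum.lessThan_Suc_shift
    using w by (simp add: G(2) del: of_nat_Suc) simp
  ultimately show ?case by blast
qed

text \<open>The continuations agree on common half-planes by the identity theorem. Each point
  therefore uses any stage whose half-plane contains it, and that stage also serves on a
  neighbourhood.\<close>

lemma zeta_sum_entire: "\<exists>G. G holomorphic_on UNIV \<and> (\<forall>w. Re w < 0 \<longrightarrow> G w = zeta_sum w)"
proof -
  obtain G where G: "\<And>K. G K holomorphic_on {w. Re w < real K}"
      "\<And>K w. Re w < 0 \<Longrightarrow> G K w = zeta_sum w"
    using zeta_sum_continuation by metis
  have agree: "G K w = G L w" if "K \<le> L" "Re w < real K" for K L w
  proof (rule analytic_continuation_open[of "{w. Re w < 0}" "{w. Re w < real K}" "G K"])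
    show "connected {w. Re w < real K}"
      by (intro convex_connected convex_halfspace_Re_lt)
    show "{w. Re w < 0} \<noteq> {}" by (auto intro!: exI[of _ "-1"])
    show "G L holomorphic_on {w. Re w < real K}"
      by (rule holomorphic_on_subset[OF G(1)[of L]]) (use that in auto)
  qed (use that G(1)[of K] G(2) in \<open>auto simp: open_halfspace_Re_lt\<close>)
  define N where "N = (\<lambda>w. nat (\<lceil>Re w\<rceil> + 1))"
  define H where "H = (\<lambda>w. G (N w) w)"
  have N: "Re w < real (N w)" for w unfolding N_def by linarith
  have HG: "H w = G K w" if "Re w < real K" for K w
    using agree[of K "N w" w] agree[of "N w" K w] N[of w] that unfolding H_def
    by (metis nat_le_linear)
  have "H field_differentiable (at w)" for w
  proof -
    have "G (N w) field_differentiable (at w)"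
      by (rule holomorphic_on_imp_differentiable_at[OF G(1)[of "N w"]]) (use N in \<open>auto simp: open_halfspace_Re_lt\<close>)
    moreover have "eventually (\<lambda>v. v \<in> {v. Re v < real (N w)}) (nhds w)"
      by (rule eventually_nhds_in_open) (use N in \<open>auto simp: open_halfspace_Re_lt\<close>)
    then have "eventually (\<lambda>v. H v = G (N w) v) (nhds w)"
      by eventually_elim (auto intro: HG)
    ultimately show ?thesis unfolding field_differentiable_def
      by (auto simp: DERIV_cong_ev[OF refl _ refl])
  qed
  then have "H holomorphic_on UNIV"
    by (simp add: holomorphic_onI field_differentiable_at_within)
  moreover have "H w = zeta_sum w" if "Re w < 0" for w
    using HG[of w 0] G(2) that by auto
  ultimately show ?thesis by blast
qed

text \<open>Discharges the definite description of zeta away from 1: the entire function divided by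
  s - 1 is a witness, and uniqueness is the identity theorem on the connected punctured plane,
  starting from Re w > 1.\<close>

lemma
  shows riemann_zeta_holomorphic: "riemann_zeta holomorphic_on - {1}"
    and riemann_zeta_eq_suminf: "\<And>s. 1 < Re s \<Longrightarrow> riemann_zeta s = (\<Sum>n. of_nat (Suc n) powr (- s))"
proof -
  obtain G where G: "G holomorphic_on UNIV" "\<And>w. Re w < 0 \<Longrightarrow> G w = zeta_sum w"
    using zeta_sum_entire by blast
  define f where "f = (\<lambda>s. G (1 - s) / (s - 1))"
  have "(\<lambda>s. G (1 - s)) holomorphic_on - {1}"
    using holomorphic_on_compose_gen[OF _ G(1), of "\<lambda>s. 1 - s" "- {1}"]
    by (force simp: o_def intro!: holomorphic_intros)
  then have f_holo: "f holomorphic_on - {1}"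
    unfolding f_def by (intro holomorphic_intros) auto
  have f_eq: "f s = (\<Sum>n. of_nat (Suc n) powr (- s))" if s: "1 < Re s" for s
  proof -
    have "s \<noteq> 1" using s by auto
    then show ?thesis
      using s unfolding f_def by (simp add: G(2) zeta_sum_def del: of_nat_Suc) 
  qed
  have series: "(\<Sum>n. 1 / of_nat (Suc n) powr s) = (\<Sum>n. of_nat (Suc n) powr (- s) :: complex)" for s
    by (simp add: powr_minus field_simps)
  have zeta: "riemann_zeta s = f s" if s: "s \<noteq> 1" for s
    unfolding riemann_zeta_def
  proof (rule the_equality)
    show "\<exists>h. h holomorphic_on - {1} \<and> (\<forall>w. 1 < Re w \<longrightarrow> h w = (\<Sum>n. 1 / of_nat (Suc n) powr w)) \<and> h s = f s"
      by (intro exI[of _ f]) (simp add: f_holo f_eq series del: of_nat_Suc)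
  next
    fix z assume "\<exists>h. h holomorphic_on - {1} \<and> (\<forall>w. 1 < Re w \<longrightarrow> h w = (\<Sum>n. 1 / of_nat (Suc n) powr w)) \<and> h s = z"
    then obtain h where h: "h holomorphic_on - {1}"
        "\<And>w. 1 < Re w \<Longrightarrow> h w = (\<Sum>n. 1 / of_nat (Suc n) powr w)" "h s = z" by blast
    have "h s = f s"
    proof (rule analytic_continuation_open[of "{w. 1 < Re w}" "- {1}" h f])
      show "connected (- {1} :: complex set)"
        by (rule connected_punctured_universe) simp
      show "{w. 1 < Re w} \<noteq> {}" by (auto intro!: exI[of _ 2])
      show "h w = f w" if "w \<in> {w. 1 < Re w}" for w
        using that h(2) f_eq series by simp
    qed (use s h f_holo in \<open>auto simp: open_halfspace_Re_gt\<close>)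
    then show "z = f s" using h(3) by simp
  qed
  show "riemann_zeta holomorphic_on - {1}"
    by (rule holomorphic_transform[OF f_holo]) (simp add: zeta)
  show "riemann_zeta s = (\<Sum>n. of_nat (Suc n) powr (- s))" if "1 < Re s" for s
    using f_eq[OF that] zeta[of s] that by fastforce
qed

text \<open>The case K = 1 of \<open>suminf_powr_rem\<close>, valid for Re s > 1, extended to Re s >
  0 because the remainder series stays holomorphic there. It is the source of explicit bounds left
  of the line Re s = 1.\<close>

lemma riemann_zeta_eq_powr_rem:
  assumes "0 < Re s" "s \<noteq> 1"
  shows "riemann_zeta s = (1 + (\<Sum>n. powr_rem 1 n (1 - s))) / (s - 1)"
proof (rule analytic_continuation_open[of "{s. 1 < Re s}" "{s. 0 < Re s} - {1}" riemann_zeta "\<lambda>s. (1 + (\<Sum>n. powr_rem 1 n (1 - s))) / (s - 1)"])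
  show "connected ({s. 0 < Re s} - {1 :: complex})"
    by (intro connected_open_delete convex_connected convex_halfspace_Re_gt) (auto simp: open_halfspace_Re_gt)
  show "open ({s. 0 < Re s} - {1})" by (intro open_delete open_halfspace_Re_gt)
  show "{s. 1 < Re s} \<noteq> {}" by (auto intro!: exI[of _ 2])
  have "(\<lambda>s. \<Sum>n. powr_rem 1 n (1 - s)) holomorphic_on {s. 0 < Re s} - {1}"
    using holomorphic_on_compose_gen[OF _ holomorphic_powr_rem_sum[of 1], of "\<lambda>s. 1 - s" "{s. 0 < Re s} - {1}"]
    by (force simp: o_def intro!: holomorphic_intros)
  then show "(\<lambda>s. (1 + (\<Sum>n. powr_rem 1 n (1 - s))) / (s - 1)) holomorphic_on {s. 0 < Re s} - {1}"
    by (intro holomorphic_intros) auto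
  show "riemann_zeta holomorphic_on {s. 0 < Re s} - {1}"
    by (rule holomorphic_on_subset[OF riemann_zeta_holomorphic]) auto
  fix z assume "z \<in> {s. 1 < Re s}"
  then have z: "1 < Re z" "z \<noteq> 1" by auto
  then show "riemann_zeta z = (1 + (\<Sum>n. powr_rem 1 n (1 - z))) / (z - 1)"
    by (simp add: suminf_powr_rem riemann_zeta_eq_suminf zeta_sum_def field_simps flip: One_nat_def)
qed (use assms in \<open>auto simp: open_halfspace_Re_gt\<close>)

section \<open>Growth of zeta\<close>

text \<open>Twice the second binomial coefficient of 1 - s has modulus |s - 1| |s|. Its first factor
  cancels the denominator s - 1, which leaves linear growth. The distance 1/4 from the pole is what
  the line Im x = -1/4 provides, where the argument of zeta has real part 3/4.\<close>

lemma riemann_zeta_bound: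
  "\<exists>B>0. \<forall>s. 1/2 \<le> Re s \<longrightarrow> 1/4 \<le> norm (s - 1) \<longrightarrow> norm (riemann_zeta s) \<le> B * (1 + norm s)"
proof -
  define B where "B = (\<Sum>n. real (Suc n) powr (-3/2))"
  have sB: "summable (\<lambda>n. real (Suc n) powr (-3/2))" by (rule summable_Suc_powr) simp
  have B0: "0 \<le> B" unfolding B_def by (rule suminf_nonneg[OF sB]) simp
  have "norm (riemann_zeta s) \<le> (4 + B) * (1 + norm s)"
    if s: "1/2 \<le> Re s" "1/4 \<le> norm (s - 1)" for s
  proof -
    have s1: "s \<noteq> 1" using s by auto
    have rem: "norm (powr_rem 1 n (1 - s)) \<le> norm (s - 1) * norm s * real (Suc n) powr (-3/2)" for n
    proof -
      have "norm (powr_rem 1 n (1 - s)) \<le> real (Suc 1) * norm (1 - s gchoose Suc 1) * real (Suc n) powr (Re (1 - s) - real (Suc 1))"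
        by (rule norm_powr_rem_le) (use s in simp)
      also have "real (Suc 1) * norm (1 - s gchoose Suc 1) = norm (s - 1) * norm s"
        by (simp add: gbinomial_prod_rev numeral_2_eq_2 norm_mult norm_divide norm_minus_commute)
      also have "norm (s - 1) * norm s * real (Suc n) powr (Re (1 - s) - real (Suc 1))
          \<le> norm (s - 1) * norm s * real (Suc n) powr (-3/2)"
        using s by (intro mult_left_mono powr_mono) auto
      finally show ?thesis .
    qed
    have sm: "summable (\<lambda>n. norm (s - 1) * norm s * real (Suc n) powr (-3/2))"
      by (intro summable_mult sB)
    have "norm (\<Sum>n. powr_rem 1 n (1 - s)) \<le> norm (s - 1) * norm s * B"
      unfolding B_def suminf_mult[OF sB, symmetric] by (rule norm_suminf_le[OF rem sm])
    then have "norm (1 + (\<Sum>n. powr_rem 1 n (1 - s))) \<le> 1 + norm (s - 1) * norm s * B"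
      using norm_triangle_ineq[of 1 "\<Sum>n. powr_rem 1 n (1 - s)"] by simp
    then have "norm (riemann_zeta s) \<le> (1 + norm (s - 1) * norm s * B) / norm (s - 1)"
      using riemann_zeta_eq_powr_rem[of s] s s1 by (simp add: norm_divide divide_right_mono)
    also have "\<dots> = 1 / norm (s - 1) + norm s * B" using s1 by (simp add: field_simps)
    also have "1 / norm (s - 1) \<le> 1 / (1/4)" using s by (intro divide_left_mono) auto
    then have "1 / norm (s - 1) + norm s * B \<le> 4 + norm s * B" by simp
    also have "\<dots> \<le> (4 + B) * (1 + norm s)" using B0 by (simp add: algebra_simps)
    finally show ?thesis .
  qed
  then show ?thesis using B0 by (intro exI[of _ "4 + B"]) auto
qed

lemma riemann_zeta_bounded_right:
  assumes "1 < a"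
  shows "\<exists>B>0. \<forall>s. a \<le> Re s \<longrightarrow> norm (riemann_zeta s) \<le> B"
proof -
  define B where "B = (\<Sum>n. real (Suc n) powr (- a))"
  have sB: "summable (\<lambda>n. real (Suc n) powr (- a))" by (rule summable_Suc_powr) (use assms in simp)
  have B0: "0 \<le> B" unfolding B_def by (rule suminf_nonneg[OF sB]) simp
  have "norm (riemann_zeta s) \<le> B + 1" if s: "a \<le> Re s" for s
  proof -
    have "norm (\<Sum>n. of_nat (Suc n) powr (- s) :: complex) \<le> B"
      unfolding B_def
    proof (rule norm_suminf_le[OF _ sB])
      show "norm (of_nat (Suc n) powr (- s) :: complex) \<le> real (Suc n) powr (- a)" for n
        unfolding norm_of_nat_powr using s by (intro powr_mono) auto
    qed
    then show ?thesis using riemann_zeta_eq_suminf[of s] s assms by simp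
  qed
  then show ?thesis using B0 by (intro exI[of _ "B + 1"]) auto
qed

section \<open>The Riemann--Siegel theta function\<close>

lemma sinh_complex_of_real: "sinh (complex_of_real x) = of_real (sinh x)"
  by (simp add: sinh_field_def exp_of_real flip: of_real_minus)

lemma cosh_complex_of_real: "cosh (complex_of_real x) = of_real (cosh x)"
  by (simp add: cosh_field_def exp_of_real flip: of_real_minus)

lemma open_theta_dom: "open theta_dom"
proof -
  have "closed ({z. Re z = 0 \<and> Im z \<ge> 1/2} \<union> {z. Re z = 0 \<and> Im z \<le> -1/2})"
    by (intro closed_Un closed_Collect_conj closed_Collect_eq closed_Collect_le continuous_intros)
  then show ?thesis unfolding theta_dom_def by (rule open_Compl)
qed

lemma connected_theta_dom: "connected theta_dom"
proof (rule starlike_imp_connected)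
  have "u *\<^sub>R z \<in> theta_dom" if z: "z \<in> theta_dom" and u: "0 \<le> u" "u \<le> 1" for z u
  proof (cases "Re z = 0 \<and> u \<noteq> 0")
    case True
    then have "\<bar>Im z\<bar> < 1/2" using z by (auto simp: theta_dom_def)
    then have "u * \<bar>Im z\<bar> < 1/2" using u mult_left_le_one_le[of "\<bar>Im z\<bar>" u] by simp
    then have "\<bar>u * Im z\<bar> < 1/2" using u by (simp add: abs_mult)
    then show ?thesis using True by (auto simp: theta_dom_def)
  next
    case False
    then show ?thesis by (auto simp: theta_dom_def)
  qed
  then have "\<forall>z\<in>theta_dom. closed_segment 0 z \<subseteq> theta_dom"
    unfolding closed_segment_def by auto
  moreover have "0 \<in> theta_dom" by (simp add: theta_dom_def)
  ultimately show "starlike theta_dom" unfolding starlike_def by blast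
qed

text \<open>The two slits are precisely the preimages of the nonpositive real axis under the two
  Gamma arguments. Hence \<open>ln_Gamma\<close> supplies a holomorphic logarithm on the whole
  domain without any choice of path.\<close>

lemma theta_dom_args:
  assumes "z \<in> theta_dom"
  shows "1/4 + \<i> * z / 2 \<notin> \<real>\<^sub>\<le>\<^sub>0" "1/4 - \<i> * z / 2 \<notin> \<real>\<^sub>\<le>\<^sub>0"
  using assms by (auto simp: theta_dom_def complex_nonpos_Reals_iff)

lemma theta_domI: "Re z \<noteq> 0 \<or> \<bar>Im z\<bar> < 1/2 \<Longrightarrow> z \<in> theta_dom"
  by (auto simp: theta_dom_def)

text \<open>Closed forms for theta and its derivatives up to order three, packed into one indexed
  family because \<open>complex_Taylor\<close> expects its derivatives in this shape. Indices above
  3 are mere padding by the third derivative.\<close>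

definition theta_deriv :: "nat \<Rightarrow> complex \<Rightarrow> complex" where
  "theta_deriv k z =
    (if k = 0 then - z / 2 * of_real (ln pi) + (ln_Gamma (1/4 + \<i> * z / 2) - ln_Gamma (1/4 - \<i> * z / 2)) / (2 * \<i>)
     else if k = 1 then - of_real (ln pi) / 2 + (Digamma (1/4 + \<i> * z / 2) + Digamma (1/4 - \<i> * z / 2)) / 4
     else if k = 2 then \<i> / 8 * (Polygamma 1 (1/4 + \<i> * z / 2) - Polygamma 1 (1/4 - \<i> * z / 2))
     else - (Polygamma 2 (1/4 + \<i> * z / 2) + Polygamma 2 (1/4 - \<i> * z / 2)) / 16)"

lemma not_nonpos_Reals_imp_not_nonpos_Ints: "z \<notin> \<real>\<^sub>\<le>\<^sub>0 \<Longrightarrow> z \<notin> \<int>\<^sub>\<le>\<^sub>0" for z :: complex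
  using nonpos_Ints_subset_nonpos_Reals by blast

lemma has_field_derivative_theta_deriv:
  assumes z: "z \<in> theta_dom" and k: "k \<le> 2"
  shows "(theta_deriv k has_field_derivative theta_deriv (Suc k) z) (at z within A)"
proof -
  note args = theta_dom_args[OF z]
  note args' = args[THEN not_nonpos_Reals_imp_not_nonpos_Ints]
  consider "k = 0" | "k = 1" | "k = 2" using k by linarith
  then show ?thesis
  proof cases
    case 1
    have "((\<lambda>z. - z / 2 * of_real (ln pi) + (ln_Gamma (1/4 + \<i> * z / 2) - ln_Gamma (1/4 - \<i> * z / 2)) / (2 * \<i>))
      has_field_derivative theta_deriv 1 z) (at z)"
      using args by (auto intro!: derivative_eq_intros simp: theta_deriv_def field_simps)
    then show ?thesis using 1 unfolding theta_deriv_def[abs_def]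
      by (auto intro: has_field_derivative_at_within)
  next
    case 2
    have "((\<lambda>z. - of_real (ln pi) / 2 + (Digamma (1/4 + \<i> * z / 2) + Digamma (1/4 - \<i> * z / 2)) / 4)
      has_field_derivative theta_deriv 2 z) (at z)"
      using args' by (auto intro!: derivative_eq_intros simp: theta_deriv_def field_simps)
    then show ?thesis using 2 unfolding theta_deriv_def[abs_def]
      by (auto intro: has_field_derivative_at_within simp: numeral_2_eq_2)
  next
    case 3
    have "((\<lambda>z. \<i> / 8 * (Polygamma 1 (1/4 + \<i> * z / 2) - Polygamma 1 (1/4 - \<i> * z / 2)))
      has_field_derivative theta_deriv 3 z) (at z)"
      using args' by (auto intro!: derivative_eq_intros simp: theta_deriv_def field_simps numeral_2_eq_2)
    then show ?thesis using 3 unfolding theta_deriv_def[abs_def]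
      by (auto intro: has_field_derivative_at_within simp: numeral_2_eq_2)
  qed
qed

lemma exp_theta_deriv_0:
  assumes z: "z \<in> theta_dom"
  shows "exp (2 * \<i> * theta_deriv 0 z) =
    of_real pi powr (- \<i> * z) * Gamma (1/4 + \<i> * z / 2) / Gamma (1/4 - \<i> * z / 2)"
proof -
  note args = theta_dom_args[OF z, THEN not_nonpos_Reals_imp_not_nonpos_Ints]
  have "2 * \<i> * theta_deriv 0 z = (- \<i> * z) * of_real (ln pi) + ln_Gamma (1/4 + \<i> * z / 2) - ln_Gamma (1/4 - \<i> * z / 2)"
    by (simp add: theta_deriv_def field_simps)
  then show ?thesis
    using args by (simp only: exp_add exp_diff) (simp add: Gamma_complex_altdef powr_def Ln_of_real)
qed

text \<open>The exponential equation fixes a candidate only modulo pi at each point. Differentiating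
  it and cancelling the nonzero exponential shows that two candidates have the same derivative, so
  they differ by a constant on the connected domain, and the value at 0 removes the
  constant.\<close>

lemma rs_theta_eq:
  assumes z: "z \<in> theta_dom"
  shows "rs_theta z = theta_deriv 0 z"
  unfolding rs_theta_def
proof (rule the_equality)
  have h: "theta_deriv 0 holomorphic_on theta_dom"
    unfolding holomorphic_on_open[OF open_theta_dom]
    using has_field_derivative_theta_deriv[of _ 0 UNIV] by auto
  show "\<exists>f. f holomorphic_on theta_dom \<and> f 0 = 0 \<and>
      (\<forall>t\<in>theta_dom. exp (2 * \<i> * f t) =
          (of_real pi) powr (- \<i> * t) * Gamma (1/4 + \<i> * t / 2) / Gamma (1/4 - \<i> * t / 2)) \<and>
      f z = theta_deriv 0 z"
    by (intro exI[of _ "theta_deriv 0"] conjI h ballI exp_theta_deriv_0) (auto simp: theta_deriv_def)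
  fix w
  assume "\<exists>f. f holomorphic_on theta_dom \<and> f 0 = 0 \<and>
      (\<forall>t\<in>theta_dom. exp (2 * \<i> * f t) =
          (of_real pi) powr (- \<i> * t) * Gamma (1/4 + \<i> * t / 2) / Gamma (1/4 - \<i> * t / 2)) \<and>
      f z = w"
  then obtain f where f: "f holomorphic_on theta_dom" "f 0 = 0" "f z = w"
      "\<And>t. t \<in> theta_dom \<Longrightarrow> exp (2 * \<i> * f t) = exp (2 * \<i> * theta_deriv 0 t)"
    using exp_theta_deriv_0 by metis
  have deriv0: "((\<lambda>t. f t - theta_deriv 0 t) has_field_derivative 0) (at t)" if t: "t \<in> theta_dom" for t
  proof -
    have df: "(f has_field_derivative deriv f t) (at t)"
      by (rule holomorphic_derivI[OF f(1) open_theta_dom t])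
    have dh: "(theta_deriv 0 has_field_derivative theta_deriv 1 t) (at t)"
      using has_field_derivative_theta_deriv[OF t, of 0 UNIV] by simp
    have "((\<lambda>t. exp (2 * \<i> * f t)) has_field_derivative exp (2 * \<i> * f t) * (2 * \<i> * deriv f t)) (at t)"
      by (auto intro!: derivative_eq_intros df)
    then have "((\<lambda>t. exp (2 * \<i> * theta_deriv 0 t)) has_field_derivative exp (2 * \<i> * f t) * (2 * \<i> * deriv f t)) (at t)"
      by (rule has_field_derivative_transform_within_open[OF _ open_theta_dom t]) (rule f(4))
    moreover have "((\<lambda>t. exp (2 * \<i> * theta_deriv 0 t)) has_field_derivative exp (2 * \<i> * theta_deriv 0 t) * (2 * \<i> * theta_deriv 1 t)) (at t)"
      by (auto intro!: derivative_eq_intros dh)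
    ultimately have "exp (2 * \<i> * f t) * (2 * \<i> * deriv f t) = exp (2 * \<i> * theta_deriv 0 t) * (2 * \<i> * theta_deriv 1 t)"
      by (rule DERIV_unique)
    then have "deriv f t = theta_deriv 1 t" using f(4)[OF t] by simp
    then show ?thesis using DERIV_diff[OF df dh] by simp
  qed
  have "continuous_on theta_dom (\<lambda>t. f t - theta_deriv 0 t)"
    by (intro continuous_on_diff holomorphic_on_imp_continuous_on f(1) h)
  then obtain c where "\<And>t. t \<in> theta_dom \<Longrightarrow> f t - theta_deriv 0 t = c"
    using DERIV_zero_connected_constant[OF connected_theta_dom open_theta_dom finite.emptyI _, of "\<lambda>t. f t - theta_deriv 0 t"] deriv0 by auto
  moreover have "f 0 - theta_deriv 0 0 = 0" "0 \<in> theta_dom"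
    by (simp_all add: f(2) theta_deriv_def theta_dom_def)
  ultimately show "w = theta_deriv 0 z" using z f(3) by fastforce
qed

lemma exp_rs_theta:
  assumes z: "z \<in> theta_dom"
  shows "exp (2 * \<i> * rs_theta z) =
    of_real pi powr (- \<i> * z) * Gamma (1/4 + \<i> * z / 2) / Gamma (1/4 - \<i> * z / 2)"
  using exp_theta_deriv_0[OF z] rs_theta_eq[OF z] by simp

lemma has_field_derivative_rs_theta:
  assumes z: "z \<in> theta_dom"
  shows "(rs_theta has_field_derivative theta_deriv 1 z) (at z)"
  using has_field_derivative_theta_deriv[OF z, of 0 UNIV]
  by (auto intro: has_field_derivative_transform_within_open[OF _ open_theta_dom z] simp: rs_theta_eq)

lemma rs_theta_holomorphic: "rs_theta holomorphic_on theta_dom"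
  unfolding holomorphic_on_open[OF open_theta_dom] using has_field_derivative_rs_theta by blast

lemma deriv_rs_theta: "z \<in> theta_dom \<Longrightarrow> deriv rs_theta z = theta_deriv 1 z"
  by (rule DERIV_imp_deriv has_field_derivative_rs_theta)+

lemma deriv_deriv_rs_theta:
  assumes z: "z \<in> theta_dom"
  shows "deriv (deriv rs_theta) z = theta_deriv 2 z"
proof (rule DERIV_imp_deriv)
  show "(deriv rs_theta has_field_derivative theta_deriv 2 z) (at z)"
    using has_field_derivative_theta_deriv[OF z, of 1 UNIV]
    by (auto intro: has_field_derivative_transform_within_open[OF _ open_theta_dom z]
        simp: deriv_rs_theta numeral_2_eq_2)
qed

lemma of_real_in_theta_dom: "of_real t \<in> theta_dom"
  by (rule theta_domI) simp

text \<open>For real t the two Gamma arguments are complex conjugates, so their quotient has modulus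
  1, as has the power of pi.\<close>

lemma Im_rs_theta_of_real: "Im (rs_theta (of_real t)) = 0"
proof -
  define a where "a = 1/4 + \<i> * of_real t / 2"
  have ca: "1/4 - \<i> * of_real t / 2 = cnj a" by (simp add: a_def complex_eq_iff)
  have "Gamma a \<noteq> 0"
    using theta_dom_args(1)[OF of_real_in_theta_dom[of t]] not_nonpos_Reals_imp_not_nonpos_Ints
    unfolding a_def Gamma_eq_zero_iff by blast
  moreover have "norm (Gamma (cnj a)) = norm (Gamma a)" using cnj_Gamma[of a] by (metis complex_mod_cnj)
  moreover have "norm (of_real pi powr (- \<i> * of_real t) :: complex) = 1"
    by (subst norm_powr_real_powr) auto
  ultimately have "norm (exp (2 * \<i> * rs_theta (of_real t))) = 1"
    unfolding exp_rs_theta[OF of_real_in_theta_dom] ca a_def[symmetric] by (simp add: norm_mult norm_divide)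
  then show ?thesis by simp
qed

text \<open>D is also the derivative of f along the real axis, where the imaginary part is
  constantly zero.\<close>

lemma has_field_derivative_real_on_reals:
  assumes f: "(f has_field_derivative D) (at (of_real t))" and real: "\<And>u. Im (f (of_real u)) = 0"
  shows "Im D = 0"
proof -
  have "(of_real has_vector_derivative 1) (at t)"
    using has_vector_derivative_of_real[OF DERIV_ident] by simp
  from field_vector_diff_chain_at[OF this f]
  have "(f \<circ> of_real has_vector_derivative D) (at t)" by simp
  then have "((\<lambda>u. Im ((f \<circ> of_real) u)) has_vector_derivative Im D) (at t)"
    by (rule bounded_linear.has_vector_derivative[OF bounded_linear_Im])
  then have "((\<lambda>u. 0) has_vector_derivative Im D) (at t)" using real by (simp add: o_def)
  then show ?thesis using vector_derivative_unique_at has_vector_derivative_const by metis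
qed

lemma Im_theta_deriv_of_real:
  "Im (theta_deriv 1 (of_real t)) = 0" "Im (theta_deriv 2 (of_real t)) = 0"
proof -
  show 1: "Im (theta_deriv 1 (of_real t)) = 0" for t
    by (rule has_field_derivative_real_on_reals[OF has_field_derivative_rs_theta[OF of_real_in_theta_dom] Im_rs_theta_of_real])
  have "(theta_deriv 1 has_field_derivative theta_deriv 2 (of_real t)) (at (of_real t))"
    using has_field_derivative_theta_deriv[OF of_real_in_theta_dom, of 1 t UNIV] by (simp add: numeral_2_eq_2)
  then show "Im (theta_deriv 2 (of_real t)) = 0"
    by (rule has_field_derivative_real_on_reals) (rule 1)
qed

section \<open>Polygamma bounds and the Taylor remainder of theta\<close>

text \<open>With r = |s + k|, split r^(-n-1) into r^(\<eta>-n), which is controlled by |Im s|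
  uniformly in k, and r^(-1-\<eta>), which is summable over k. The resulting loss of \<eta> replaces
  asymptotic expansions and is covered by \<epsilon>.\<close>

lemma norm_Polygamma_le:
  assumes n: "1 \<le> n" and \<eta>: "0 < \<eta>" "\<eta> \<le> 1"
  shows "\<exists>B>0. \<forall>s::complex. -3/4 \<le> Re s \<longrightarrow> 1 \<le> \<bar>Im s\<bar> \<longrightarrow> norm (Polygamma n s) \<le> B * \<bar>Im s\<bar> powr (\<eta> - real n)"
proof -
  define h where "h = (\<lambda>k. (real (Suc k) / 8) powr - (1 + \<eta>))"
  have "summable (\<lambda>k. real (Suc k) powr - (1 + \<eta>) / 8 powr - (1 + \<eta>))"
    using \<eta> by (intro summable_divide summable_Suc_powr) simp
  then have h: "summable h" unfolding h_def by (subst powr_divide) auto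
  have h0: "0 \<le> suminf h" by (intro suminf_nonneg h) (simp add: h_def)
  have "norm (Polygamma n s) \<le> (fact n * suminf h + 1) * \<bar>Im s\<bar> powr (\<eta> - real n)"
    if s: "-3/4 \<le> Re s" "1 \<le> \<bar>Im s\<bar>" for s :: complex
  proof -
    define c where "c = \<bar>Im s\<bar> powr (\<eta> - real n)"
    have term_le: "norm (inverse ((s + of_nat k) ^ Suc n)) \<le> c * h k" for k
    proof -
      define r where "r = norm (s + of_nat k)"
      have r1: "\<bar>Im s\<bar> \<le> r" using abs_Im_le_cmod[of "s + of_nat k"] by (simp add: r_def)
      \<comment> \<open>For k > 0 the real part is at least k - 3/4, and k = 1 gives exactly 2/8.
        For k = 0 the imaginary part must supply the bound.\<close>
      have r2: "real (Suc k) / 8 \<le> r"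
      proof (cases "k = 0")
        case True
        then show ?thesis using r1 s by simp
      next
        case False
        then have "real (Suc k) / 8 \<le> Re (s + of_nat k)" using s by (simp add: field_simps)
        also have "\<dots> \<le> r" unfolding r_def by (rule complex_Re_le_cmod)
        finally show ?thesis .
      qed
      have r: "r > 0" using r1 s by linarith
      have "norm (inverse ((s + of_nat k) ^ Suc n)) = inverse (r ^ Suc n)"
        by (simp add: r_def norm_inverse norm_power norm_mult)
      also have "\<dots> = r powr - real (Suc n)"
        using r by (simp only: powr_minus powr_realpow)
      also have "\<dots> = r powr (\<eta> - real n) * r powr - (1 + \<eta>)"
        by (simp add: powr_add[symmetric] algebra_simps)
      also have "\<dots> \<le> c * h k"
        unfolding c_def h_def using r1 r2 s n \<eta> by (intro mult_mono powr_mono2') auto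
      finally show ?thesis .
    qed
    have "norm (\<Sum>k. inverse ((s + of_nat k) ^ Suc n)) \<le> (\<Sum>k. c * h k)"
      by (rule norm_suminf_le[OF term_le summable_mult[OF h]])
    also have "\<dots> = c * suminf h" by (rule suminf_mult[OF h])
    finally have "fact n * norm (\<Sum>k. inverse ((s + of_nat k) ^ Suc n)) \<le> fact n * (c * suminf h)"
      by (intro mult_left_mono) auto
    also have "fact n * norm (\<Sum>k. inverse ((s + of_nat k) ^ Suc n)) = norm (Polygamma n s)"
      using n by (simp add: Polygamma_def norm_mult norm_power)
    finally have "norm (Polygamma n s) \<le> fact n * (c * suminf h)" .
    also have "\<dots> \<le> (fact n * suminf h + 1) * c" by (simp add: c_def algebra_simps)
    finally show ?thesis by (simp only: c_def)
  qed
  moreover have "fact n * suminf h + 1 > 0" using h0 by (simp add: add_nonneg_pos)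
  ultimately show ?thesis by blast
qed

lemma theta_deriv_bounds:
  assumes \<eta>: "0 < \<eta>" "\<eta> \<le> 1"
  shows "\<exists>B>0. \<forall>z. 2 \<le> Re z \<longrightarrow> \<bar>Im z\<bar> \<le> 2 \<longrightarrow> norm (theta_deriv 2 z) \<le> B * Re z powr (\<eta> - 1)"
    and "\<exists>B>0. \<forall>z. 2 \<le> Re z \<longrightarrow> \<bar>Im z\<bar> \<le> 2 \<longrightarrow> norm (theta_deriv 3 z) \<le> B * Re z powr (\<eta> - 2)"
proof -
  \<comment> \<open>The strip |Im z| <= 2 contains all heights needed for 0 < \<sigma> < 2. Its
    extreme heights give the real part -3/4.\<close>
  have args: "-3/4 \<le> Re (1/4 + \<i> * z / 2)" "1 \<le> \<bar>Im (1/4 + \<i> * z / 2)\<bar>"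
    "-3/4 \<le> Re (1/4 - \<i> * z / 2)" "1 \<le> \<bar>Im (1/4 - \<i> * z / 2)\<bar>"
    "\<bar>Im (1/4 + \<i> * z / 2)\<bar> = Re z / 2" "\<bar>Im (1/4 - \<i> * z / 2)\<bar> = Re z / 2"
    if "2 \<le> Re z" "\<bar>Im z\<bar> \<le> 2" for z
    using that by auto
  obtain B where B: "B > 0" "\<And>s::complex. -3/4 \<le> Re s \<Longrightarrow> 1 \<le> \<bar>Im s\<bar> \<Longrightarrow> norm (Polygamma 1 s) \<le> B * \<bar>Im s\<bar> powr (\<eta> - real 1)"
    using norm_Polygamma_le[of 1, OF _ \<eta>] by auto
  show "\<exists>B>0. \<forall>z. 2 \<le> Re z \<longrightarrow> \<bar>Im z\<bar> \<le> 2 \<longrightarrow> norm (theta_deriv 2 z) \<le> B * Re z powr (\<eta> - 1)"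
  proof (intro exI[of _ "B / 2 powr (\<eta> - 1)"] conjI allI impI)
    fix z assume z: "2 \<le> Re z" "\<bar>Im z\<bar> \<le> 2"
    let ?P = "\<lambda>s::complex. Polygamma 1 s"
    have "norm (theta_deriv 2 z) \<le> (norm (?P (1/4 + \<i> * z / 2)) + norm (?P (1/4 - \<i> * z / 2))) / 8"
      using norm_triangle_ineq4[of "?P (1/4 + \<i> * z / 2)" "?P (1/4 - \<i> * z / 2)"]
      by (simp add: theta_deriv_def norm_mult norm_divide)
    also have "\<dots> \<le> (B * (Re z / 2) powr (\<eta> - 1) + B * (Re z / 2) powr (\<eta> - 1)) / 8"
      using B(2)[OF args(1,2)[OF z]] B(2)[OF args(3,4)[OF z]] unfolding args(5,6)[OF z] by simp
    also have "\<dots> \<le> B * (Re z / 2) powr (\<eta> - 1)"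
      using B(1) by simp
    also have "\<dots> = B / 2 powr (\<eta> - 1) * Re z powr (\<eta> - 1)"
      using z by (simp add: powr_divide)
    finally show "norm (theta_deriv 2 z) \<le> B / 2 powr (\<eta> - 1) * Re z powr (\<eta> - 1)" .
  qed (use B in auto)
  obtain B where B: "B > 0" "\<And>s::complex. -3/4 \<le> Re s \<Longrightarrow> 1 \<le> \<bar>Im s\<bar> \<Longrightarrow> norm (Polygamma 2 s) \<le> B * \<bar>Im s\<bar> powr (\<eta> - real 2)"
    using norm_Polygamma_le[of 2, OF _ \<eta>] by auto
  show "\<exists>B>0. \<forall>z. 2 \<le> Re z \<longrightarrow> \<bar>Im z\<bar> \<le> 2 \<longrightarrow> norm (theta_deriv 3 z) \<le> B * Re z powr (\<eta> - 2)"
  proof (intro exI[of _ "B / 2 powr (\<eta> - 2)"] conjI allI impI)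
    fix z assume z: "2 \<le> Re z" "\<bar>Im z\<bar> \<le> 2"
    let ?P = "\<lambda>s::complex. Polygamma 2 s"
    have "norm (theta_deriv 3 z) = norm (- (?P (1/4 + \<i> * z / 2) + ?P (1/4 - \<i> * z / 2))) / 16"
      unfolding theta_deriv_def by (simp add: norm_divide del: minus_add_distrib)
    also have "\<dots> \<le> (norm (?P (1/4 + \<i> * z / 2)) + norm (?P (1/4 - \<i> * z / 2))) / 16"
      unfolding norm_minus_cancel by (intro divide_right_mono norm_triangle_ineq) auto
    also have "\<dots> \<le> (B * (Re z / 2) powr (\<eta> - 2) + B * (Re z / 2) powr (\<eta> - 2)) / 16"
      using B(2)[OF args(1,2)[OF z]] B(2)[OF args(3,4)[OF z]] unfolding args(5,6)[OF z] by simp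
    also have "\<dots> \<le> B * (Re z / 2) powr (\<eta> - 2)"
      using B(1) by simp
    also have "\<dots> = B / 2 powr (\<eta> - 2) * Re z powr (\<eta> - 2)"
      using z by (simp add: powr_divide)
    finally show "norm (theta_deriv 3 z) \<le> B / 2 powr (\<eta> - 2) * Re z powr (\<eta> - 2)" .
  qed (use B in auto)
qed

definition theta_rem :: "real \<Rightarrow> complex \<Rightarrow> complex" where
  "theta_rem t x = rs_theta (of_real t + x) - rs_theta (of_real t)
     - (x * theta_deriv 1 (of_real t) + x\<^sup>2 / 2 * theta_deriv 2 (of_real t))"

lemma norm_theta_rem_le:
  assumes \<eta>: "0 < \<eta>" "\<eta> \<le> 1"
  shows "\<exists>B>0. \<forall>t x. 4 \<le> t \<longrightarrow> norm x \<le> t / 2 \<longrightarrow> \<bar>Im x\<bar> \<le> 2 \<longrightarrow>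
    norm (theta_rem t x) \<le> B * norm x ^ 3 * t powr (\<eta> - 2)"
proof -
  obtain B where B: "B > 0" "\<And>z. 2 \<le> Re z \<Longrightarrow> \<bar>Im z\<bar> \<le> 2 \<Longrightarrow> norm (theta_deriv 3 z) \<le> B * Re z powr (\<eta> - 2)"
    using theta_deriv_bounds(2)[OF \<eta>] by blast
  define B' where "B' = B / 2 powr (\<eta> - 2)"
  show ?thesis
  proof (intro exI[of _ B'] conjI allI impI)
    show "0 < B'" using B by (simp add: B'_def)
    fix t x assume t: "4 \<le> t" "norm x \<le> t / 2" "\<bar>Im x\<bar> \<le> 2"
    \<comment> \<open>Convex, with t + x inside because |x| <= t/2. Since t >= 4, it lies in Re z >=
      2, off the slits and within the range of the bound on the third derivative.\<close>
    define S where "S = {z. t / 2 \<le> Re z} \<inter> {z. Im z \<le> 2} \<inter> {z. -2 \<le> Im z}"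
    have Sdom: "z \<in> theta_dom" if "z \<in> S" for z
      using that t by (intro theta_domI) (auto simp: S_def)
    have x: "of_real t + x \<in> S" "of_real t \<in> S"
      using t abs_Re_le_cmod[of x] by (auto simp: S_def)
    have "cmod (theta_deriv 0 (of_real t + x) - (\<Sum>i\<le>2. theta_deriv i (of_real t) * (of_real t + x - of_real t) ^ i / fact i))
        \<le> B' * t powr (\<eta> - 2) * cmod (of_real t + x - of_real t) ^ Suc 2 / fact 2"
    proof (rule complex_Taylor)
      show "convex S" unfolding S_def
        by (intro convex_Int convex_halfspace_Re_ge convex_halfspace_Im_le convex_halfspace_Im_ge)
      show "(theta_deriv i has_field_derivative theta_deriv (Suc i) z) (at z within S)" if "z \<in> S" "i \<le> 2" for i z
        using that by (intro has_field_derivative_theta_deriv Sdom)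
      show "cmod (theta_deriv (Suc 2) z) \<le> B' * t powr (\<eta> - 2)" if z: "z \<in> S" for z
      proof -
        have "cmod (theta_deriv 3 z) \<le> B * Re z powr (\<eta> - 2)"
          by (rule B(2)) (use z t in \<open>auto simp: S_def\<close>)
        also have "\<dots> \<le> B * (t / 2) powr (\<eta> - 2)"
          using z t \<eta> B(1) by (intro mult_left_mono powr_mono2') (auto simp: S_def)
        also have "\<dots> = B' * t powr (\<eta> - 2)" using t by (simp add: B'_def powr_divide)
        finally show ?thesis by simp
      qed
    qed (use x in auto)
    also have "theta_deriv 0 (of_real t + x) - (\<Sum>i\<le>2. theta_deriv i (of_real t) * (of_real t + x - of_real t) ^ i / fact i)
        = theta_rem t x"
      using rs_theta_eq[OF Sdom[OF x(1)]] rs_theta_eq[OF Sdom[OF x(2)]]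
      unfolding theta_rem_def by (simp add: numeral_2_eq_2 algebra_simps)
    also have "B' * t powr (\<eta> - 2) * cmod (of_real t + x - of_real t) ^ Suc 2 / fact 2 \<le> B' * norm x ^ 3 * t powr (\<eta> - 2)"
      using \<open>0 < B'\<close> by (simp add: numeral_3_eq_3 field_simps)
    finally show "norm (theta_rem t x) \<le> B' * norm x ^ 3 * t powr (\<eta> - 2)" .
  qed
qed

section \<open>Modulus of exp(\<i> theta) on the lines Im z = -1/4 and Im z = -1/2\<close>

text \<open>Compares the Euler products factor by factor.\<close>
lemma norm_Gamma_ratio_le:
  fixes z :: complex
  assumes z: "0 < Re z" and d: "0 \<le> d"
  shows "norm (Gamma z) * Gamma (Re z + d) \<le> Gamma (Re z) * norm (Gamma (z + of_real d))"
proof (rule LIMSEQ_le)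
  show "(\<lambda>n. norm (Gamma_series z n) * Gamma_series (Re z + d) n) \<longlonglongrightarrow> norm (Gamma z) * Gamma (Re z + d)"
    "(\<lambda>n. Gamma_series (Re z) n * norm (Gamma_series (z + of_real d) n)) \<longlonglongrightarrow> Gamma (Re z) * norm (Gamma (z + of_real d))"
    by (intro tendsto_intros)+
  have factor: "(Re z + real k) * norm (z + of_real d + of_nat k) \<le> norm (z + of_nat k) * (Re z + d + real k)" for k
  proof (rule power2_le_imp_le)
    define p q where "p = Re z + real k" and "q = p + d"
    have pq: "0 \<le> p" "p \<le> q" using z d by (auto simp: p_def q_def)
    have "p\<^sup>2 * (q\<^sup>2 + (Im z)\<^sup>2) \<le> (p\<^sup>2 + (Im z)\<^sup>2) * q\<^sup>2"
      using mult_right_mono[OF power_mono[OF pq(2,1), of 2], of "(Im z)\<^sup>2"] by (simp add: algebra_simps)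
    then show "((Re z + real k) * norm (z + of_real d + of_nat k))\<^sup>2 \<le> (norm (z + of_nat k) * (Re z + d + real k))\<^sup>2"
      by (simp add: power_mult_distrib cmod_power2 p_def q_def add_ac)
  qed (use z d in simp)
  have "norm (Gamma_series z n) * Gamma_series (Re z + d) n \<le> Gamma_series (Re z) n * norm (Gamma_series (z + of_real d) n)" for n
  proof -
    define L where "L = ln (real n)"
    define P where "P = (\<Prod>k=0..n. norm (z + of_nat k) * (Re z + d + real k))"
    define Q where "Q = (\<Prod>k=0..n. (Re z + real k) * norm (z + of_real d + of_nat k))"
    define A where "A = fact n * exp (Re z * L) * (fact n * exp ((Re z + d) * L))"
    have *: "norm (Gamma_series w n) = fact n * exp (Re w * L) / (\<Prod>k=0..n. norm (w + of_nat k))" for w :: complex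
      by (simp add: Gamma_series_def norm_mult norm_divide pochhammer_Suc_prod prod_norm L_def)
    have **: "Gamma_series r n = fact n * exp (r * L) / (\<Prod>k=0..n. r + real k)" for r :: real
      by (simp add: Gamma_series_def pochhammer_Suc_prod L_def)
    have "Q \<le> P" unfolding P_def Q_def using z by (intro prod_mono conjI factor) auto
    moreover have "0 < Q" unfolding Q_def
      by (intro prod_pos ballI mult_pos_pos) (use z d in \<open>auto simp: complex_eq_iff add_nonneg_pos add_pos_nonneg\<close>)
    ultimately have "A / P \<le> A / Q" by (intro divide_left_mono) (auto simp: A_def)
    then show ?thesis unfolding * ** P_def Q_def A_def prod.distrib by (simp add: mult_ac)
  qed
  then show "\<exists>N. \<forall>n\<ge>N. norm (Gamma_series z n) * Gamma_series (Re z + d) n \<le> Gamma_series (Re z) n * norm (Gamma_series (z + of_real d) n)"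
    by blast
qed

lemma norm_exp_ii_squared: "norm (exp (\<i> * w)) ^ 2 = norm (exp (2 * \<i> * w))"
  by (simp add: power2_eq_square flip: norm_mult exp_add)

text \<open>Needed for all real v, since U integrates over the whole line and Taylor expansion at t
  says nothing about distant points. The Gamma arguments have real parts 3/8 and 1/8; moving the
  first by 3/4 makes them differ by 1 after conjugating the second. The functional equation then
  bounds the quotient by a multiple of |b|.\<close>

lemma norm_exp_rs_theta_quarter_line:
  "\<exists>B>0. \<forall>v. norm (exp (\<i> * rs_theta (of_real v - \<i> / 4))) \<le> B * (1 + \<bar>v\<bar>)"
proof -
  define K where "K = Gamma (3/8 :: real) / Gamma (9/8)"
  have K: "K > 0" unfolding K_def by (intro divide_pos_pos Gamma_real_pos) auto
  have "norm (exp (\<i> * rs_theta (of_real v - \<i> / 4))) \<le> (1 + K) * (1 + \<bar>v\<bar>)" for v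
  proof (rule power2_le_imp_le)
    define a where "a = 3/8 + \<i> * of_real v / 2"
    define b where "b = 1/8 + \<i> * of_real v / 2"
    define z where "z = of_real v - \<i> / 4"
    have z: "z \<in> theta_dom" by (rule theta_domI) (simp add: z_def)
    have ab: "1/4 + \<i> * z / 2 = a" "1/4 - \<i> * z / 2 = cnj b" "a + of_real (3/4) = b + 1"
      by (simp_all add: z_def a_def b_def complex_eq_iff)
    have bn: "b \<notin> \<int>\<^sub>\<le>\<^sub>0" by (rule not_nonpos_Reals_imp_not_nonpos_Ints) (simp add: b_def complex_nonpos_Reals_iff)
    have "norm (Gamma a) * Gamma (9/8) \<le> Gamma (3/8) * norm (Gamma (b + 1))"
      using norm_Gamma_ratio_le[of a "3/4"] ab(3) by (simp add: a_def)
    then have "norm (Gamma a) \<le> K * (norm b * norm (Gamma b))"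
      unfolding Gamma_plus1[OF bn] norm_mult K_def by (simp add: field_simps)
    moreover have "norm (Gamma b) > 0" using bn by (simp add: Gamma_eq_zero_iff)
    ultimately have "norm (Gamma a) / norm (Gamma b) \<le> K * norm b" by (simp add: field_simps)
    moreover have "norm (Gamma (cnj b)) = norm (Gamma b)" using cnj_Gamma[of b] by (metis complex_mod_cnj)
    moreover have "norm (of_real pi powr (- \<i> * z) :: complex) \<le> 1"
    proof -
      have "norm (of_real pi powr (- \<i> * z) :: complex) = pi powr (- 1/4)"
        by (subst norm_powr_real_powr) (auto simp: z_def)
      also have "\<dots> \<le> pi powr 0" using pi_gt3 by (intro powr_mono) auto
      finally show ?thesis using pi_gt_zero by simp
    qed
    ultimately have "norm (exp (2 * \<i> * rs_theta z)) \<le> 1 * (K * norm b)"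
      unfolding exp_rs_theta[OF z] ab unfolding norm_divide norm_mult times_divide_eq_right[symmetric]
      by (intro mult_mono) auto
    also have "norm b \<le> 1 + \<bar>v\<bar>"
      using norm_triangle_ineq[of "1/8" "\<i> * of_real v / 2"] by (simp add: b_def norm_mult norm_divide)
    also have "1 * (K * (1 + \<bar>v\<bar>)) \<le> ((1 + K) * (1 + \<bar>v\<bar>))\<^sup>2"
    proof -
      have "1 \<le> (1 + K) * (1 + \<bar>v\<bar>)" using K by (intro mult_ge1_I) auto
      then have "(1 + K) * (1 + \<bar>v\<bar>) \<le> ((1 + K) * (1 + \<bar>v\<bar>))\<^sup>2" by (rule self_le_power) simp
      then show ?thesis by (simp add: algebra_simps)
    qed
    finally show "(norm (exp (\<i> * rs_theta (of_real v - \<i> / 4))))\<^sup>2 \<le> ((1 + K) * (1 + \<bar>v\<bar>))\<^sup>2"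
      using K unfolding norm_exp_ii_squared z_def by simp
  qed (use K in simp)
  then show ?thesis using K by (intro exI[of _ "1 + K"]) auto
qed

text \<open>On this line the Gamma arguments are 1/2 + \<i>y and -\<i>y with y = t/2. The reflection
  formula evaluates both squared moduli, and their quotient is y tanh(pi y), at most y. The fourth
  power appears because the definition gives exp(2\<i> theta) and reflection gives squares.\<close>

lemma norm_exp_rs_theta_half_line:
  assumes t: "0 < t"
  shows "norm (exp (\<i> * rs_theta (of_real t - \<i> / 2))) ^ 4 \<le> t"
proof -
  define y where "y = t / 2"
  define z where "z = of_real t - \<i> / 2"
  have y: "y > 0" using t by (simp add: y_def)
  have z: "z \<in> theta_dom" using t by (intro theta_domI) (simp add: z_def)
  define a where "a = 1/2 + \<i> * of_real y"
  define b where "b = - \<i> * complex_of_real y"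
  have ab: "1/4 + \<i> * z / 2 = a" "1/4 - \<i> * z / 2 = b"
    by (simp_all add: z_def a_def b_def y_def complex_eq_iff)
  have sin_iy: "norm (sin (\<i> * of_real (pi * y))) = sinh (pi * y)" "sinh (pi * y) > 0"
  proof -
    have "sinh (complex_of_real (pi * y)) = - \<i> * sin (\<i> * of_real (pi * y))" by (rule sinh_conv_sin)
    then have "norm (sin (\<i> * of_real (pi * y))) = norm (sinh (complex_of_real (pi * y)))"
      by (simp add: norm_mult)
    also have "sinh (complex_of_real (pi * y)) = of_real (sinh (pi * y))" by (rule sinh_complex_of_real)
    finally show "norm (sin (\<i> * of_real (pi * y))) = sinh (pi * y)" using y by simp
    show "sinh (pi * y) > 0" using y by simp
  qed
  have Ga: "norm (Gamma a) ^ 2 = pi / cosh (pi * y)"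
  proof -
    have "1 - a = cnj a" by (simp add: a_def complex_eq_iff)
    then have "norm (Gamma a) ^ 2 = norm (Gamma a * Gamma (1 - a))"
      by (simp add: norm_mult power2_eq_square flip: cnj_Gamma)
    also have "\<dots> = pi / norm (sin (of_real pi * a))"
      by (simp add: Gamma_reflection_complex norm_divide)
    also have "sin (of_real pi * a) = cos (\<i> * of_real (pi * y))"
      unfolding a_def by (simp add: algebra_simps sin_add flip: sin_of_real cos_of_real)
    also have "\<dots> = of_real (cosh (pi * y))" by (simp only: cosh_conv_cos[symmetric] cosh_complex_of_real)
    finally show ?thesis by simp
  qed
  have Gb: "norm (Gamma b) ^ 2 = pi / (y * sinh (pi * y))"
  proof -
    have bn: "cnj b \<notin> \<int>\<^sub>\<le>\<^sub>0" using y by (intro notI, elim nonpos_Ints_cases) (simp add: b_def complex_eq_iff)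
    have nb: "norm b = y" using y by (simp add: b_def norm_mult)
    have "1 - b = cnj b + 1" by (simp add: b_def complex_eq_iff)
    then have "norm (Gamma (1 - b)) = y * norm (Gamma b)"
      using nb by (simp only: Gamma_plus1[OF bn] norm_mult complex_mod_cnj flip: cnj_Gamma)
    then have "y * norm (Gamma b) ^ 2 = norm (Gamma b * Gamma (1 - b))"
      by (simp add: norm_mult power2_eq_square)
    also have "\<dots> = pi / norm (sin (of_real pi * b))"
      by (simp add: Gamma_reflection_complex norm_divide)
    also have "of_real pi * b = - (\<i> * of_real (pi * y))" by (simp add: b_def)
    also have "norm (sin \<dots>) = sinh (pi * y)" using sin_iy(1) by (simp only: sin_minus norm_minus_cancel)
    finally show ?thesis using y sin_iy(2) by (simp add: field_simps)
  qed
  have "norm (of_real pi powr (- \<i> * z) :: complex) = pi powr (- 1/2)"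
    by (subst norm_powr_real_powr) (auto simp: z_def)
  also have "\<dots> \<le> pi powr 0" using pi_gt3 by (intro powr_mono) auto
  finally have p: "norm (of_real pi powr (- \<i> * z) :: complex) \<le> 1" using pi_gt_zero by simp
  have le: "norm (exp (2 * \<i> * rs_theta z)) \<le> 1 * (norm (Gamma a) / norm (Gamma b))"
    unfolding exp_rs_theta[OF z] ab unfolding norm_divide norm_mult times_divide_eq_right[symmetric]
    using p by (intro mult_right_mono) auto
  have "norm (exp (\<i> * rs_theta z)) ^ 4 = (norm (exp (2 * \<i> * rs_theta z)))\<^sup>2"
    unfolding norm_exp_ii_squared[symmetric] by simp
  also have "\<dots> \<le> (1 * (norm (Gamma a) / norm (Gamma b)))\<^sup>2"
    by (rule power_mono[OF le norm_ge_zero])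
  also have "(1 * (norm (Gamma a) / norm (Gamma b)))\<^sup>2 = y * (sinh (pi * y) / cosh (pi * y))"
    unfolding mult_1_left power_divide Ga Gb by simp
  also have "\<dots> \<le> y * 1"
    using y sinh_less_cosh_real[of "pi * y"] by (intro mult_left_mono) (auto simp: divide_le_eq)
  finally show ?thesis using t by (simp add: y_def z_def)
qed

section \<open>Truncation and contour shifts\<close>

lemma exponential_tail_integral_bound:
  fixes f :: "real \<Rightarrow> complex"
  assumes cont: "continuous_on UNIV f" and bnd: "\<And>u. norm (f u) \<le> M * exp (- \<bar>u\<bar>)" and b: "0 \<le> b"
  shows "norm (integral UNIV f - integral {-b..b} f) \<le> 2 * M * exp (- b)"
proof -
  have right: "((\<lambda>u. exp (- \<bar>u\<bar>)) has_integral exp (- b)) {b..}"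
    using has_integral_exp_minus_to_infinity[of 1 b] b by (auto elim: has_integral_eq[rotated])
  \<comment> \<open>The left tail comes from the right one by u -> -u, and the reflection rule
    speaks of absolute integrability.\<close>
  have "(\<lambda>u. exp (- \<bar>u\<bar>)) absolutely_integrable_on {b..}"
    using right by (intro nonnegative_absolutely_integrable_1) auto
  moreover have "integral {b..} (\<lambda>u. exp (- \<bar>u\<bar>)) = exp (- b)" using right by (rule integral_unique)
  ultimately have "(\<lambda>u. exp (- \<bar>u\<bar>)) absolutely_integrable_on {..-b} \<and> integral {..-b} (\<lambda>u. exp (- \<bar>u\<bar>)) = exp (- b)"
    using has_absolute_integral_reflect_real[of "{b..}" "{..-b}" "\<lambda>u. exp (- \<bar>u\<bar>)" "exp (- b)"] by auto
  then have left: "((\<lambda>u. exp (- \<bar>u\<bar>)) has_integral exp (- b)) {..-b}"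
    by (metis absolutely_integrable_on_def has_integral_integral)
  have tail: "f integrable_on S \<and> norm (integral S f) \<le> M * exp (- b)"
    if S: "S \<in> sets lebesgue" and g: "((\<lambda>u. exp (- \<bar>u\<bar>)) has_integral exp (- b)) S" for S
  proof -
    have gM: "((\<lambda>u. M * exp (- \<bar>u\<bar>)) has_integral M * exp (- b)) S"
      by (rule has_integral_mult_right[OF g])
    have "f integrable_on S"
    proof (rule measurable_bounded_by_integrable_imp_integrable[OF _ _ _ S])
      show "f \<in> borel_measurable (lebesgue_on S)"
        by (rule continuous_imp_measurable_on_sets_lebesgue[OF continuous_on_subset[OF cont] S]) simp
      show "(\<lambda>u. M * exp (- \<bar>u\<bar>)) integrable_on S" using gM by blast
    qed (rule bnd)
    moreover from this have "norm (integral S f) \<le> integral S (\<lambda>u. M * exp (- \<bar>u\<bar>))"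
      using gM by (intro integral_norm_bound_integral bnd) auto
    ultimately show ?thesis using integral_unique[OF gM] by (simp only:) 
  qed
  have R: "f integrable_on {b..}" "norm (integral {b..} f) \<le> M * exp (- b)"
    using tail[OF _ right] by auto
  have L: "f integrable_on {..-b}" "norm (integral {..-b} f) \<le> M * exp (- b)"
    using tail[OF _ left] by auto
  have mid: "f integrable_on {-b..b}"
    by (intro integrable_continuous_interval continuous_on_subset[OF cont]) auto
  have "(f has_integral integral {..-b} f + integral {-b..b} f) ({..-b} \<union> {-b..b})"
  proof (rule has_integral_Un)
    have "{..-b} \<inter> {-b..b} \<subseteq> {-b}" by auto
    then show "negligible ({..-b} \<inter> {-b..b})" by (rule negligible_subset[rotated]) simp
  qed (use L mid in \<open>auto intro: integrable_integral\<close>)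
  then have "(f has_integral integral {..-b} f + integral {-b..b} f + integral {b..} f) (({..-b} \<union> {-b..b}) \<union> {b..})"
  proof (rule has_integral_Un)
    have "({..-b} \<union> {-b..b}) \<inter> {b..} \<subseteq> {b}" using b by auto
    then show "negligible (({..-b} \<union> {-b..b}) \<inter> {b..})" by (rule negligible_subset[rotated]) simp
  qed (use R in \<open>auto intro: integrable_integral\<close>)
  moreover have "({..-b} \<union> {-b..b}) \<union> {b..} = UNIV" using b by auto
  ultimately have "integral UNIV f = integral {..-b} f + integral {-b..b} f + integral {b..} f"
    by (simp add: integral_unique)
  then have "integral UNIV f - integral {-b..b} f = integral {..-b} f + integral {b..} f" by simp
  then show ?thesis using L(2) R(2) norm_triangle_ineq[of "integral {..-b} f" "integral {b..} f"] by simp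
qed

abbreviation (input) horizontal_path :: "real \<Rightarrow> real \<Rightarrow> real \<Rightarrow> complex" where
  "horizontal_path b \<sigma> \<equiv> linepath (- of_real b - \<i> * of_real \<sigma>) (of_real b - \<i> * of_real \<sigma>)"

lemma contour_integral_horizontal_path:
  assumes b: "0 < b"
  shows "contour_integral (horizontal_path b \<sigma>) f = integral {-b..b} (\<lambda>u. f (of_real u - \<i> * of_real \<sigma>))"
proof -
  have "horizontal_path b \<sigma> = (+) (- \<i> * of_real \<sigma>) \<circ> linepath (of_real (-b)) (of_real b)"
    by (auto simp: linepath_def fun_eq_iff algebra_simps)
  then show ?thesis
    using b by (simp only: contour_integral_translate) (subst contour_integral_linepath_Reals_eq, auto)
qed

text \<open>With a primitive on the convex set S, the difference of the two horizontal integrals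
  becomes the difference of the two vertical ones, each of length |\<sigma> - \<tau>|. Thus only
  values on the sides matter, and the order of \<sigma> and \<tau> is irrelevant.\<close>

lemma horizontal_path_shift_bound:
  assumes f: "f holomorphic_on S" and S: "open S" "convex S"
    and corners: "of_real b - \<i> * of_real \<sigma> \<in> S" "- of_real b - \<i> * of_real \<sigma> \<in> S"
      "of_real b - \<i> * of_real \<tau> \<in> S" "- of_real b - \<i> * of_real \<tau> \<in> S"
    and M: "\<And>x. x \<in> S \<Longrightarrow> \<bar>Re x\<bar> = \<bar>b\<bar> \<Longrightarrow> norm (f x) \<le> M" and M0: "0 \<le> M"
  shows "norm (contour_integral (horizontal_path b \<sigma>) f - contour_integral (horizontal_path b \<tau>) f) \<le> 2 * M * \<bar>\<sigma> - \<tau>\<bar>"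
proof -
  obtain F where F: "\<And>x. x \<in> S \<Longrightarrow> (F has_field_derivative f x) (at x within S)"
    using holomorphic_convex_primitive'[OF S(2,1) f] by auto
  have prim: "(f has_contour_integral F y - F x) (linepath x y)" if "x \<in> S" "y \<in> S" for x y
    using contour_integral_primitive[OF F, where g = "linepath x y"] closed_segment_subset[OF that S(2)] by simp
  have side: "norm (F (c - \<i> * of_real \<sigma>) - F (c - \<i> * of_real \<tau>)) \<le> M * \<bar>\<sigma> - \<tau>\<bar>"
    if c: "c - \<i> * of_real \<sigma> \<in> S" "c - \<i> * of_real \<tau> \<in> S" "\<bar>Re c\<bar> = \<bar>b\<bar>" for c
  proof -
    have "norm (F (c - \<i> * of_real \<sigma>) - F (c - \<i> * of_real \<tau>)) \<le> M * norm (c - \<i> * of_real \<sigma> - (c - \<i> * of_real \<tau>))"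
    proof (rule has_contour_integral_bound_linepath[OF prim[OF c(2,1)] M0])
      fix x assume x: "x \<in> closed_segment (c - \<i> * of_real \<tau>) (c - \<i> * of_real \<sigma>)"
      then have "x \<in> S" using closed_segment_subset[OF c(2,1) S(2)] by blast
      moreover have "Re x = Re c" using x by (auto simp: closed_segment_same_Re)
      ultimately show "norm (f x) \<le> M" using c(3) M by simp
    qed
    also have "c - \<i> * of_real \<sigma> - (c - \<i> * of_real \<tau>) = - (\<i> * of_real (\<sigma> - \<tau>))" by (simp add: algebra_simps)
    also have "norm \<dots> = \<bar>\<sigma> - \<tau>\<bar>" by (simp only: norm_minus_cancel norm_mult norm_ii norm_of_real mult_1_left)
    finally show ?thesis .
  qed
  have "contour_integral (horizontal_path b \<sigma>) f = F (of_real b - \<i> * of_real \<sigma>) - F (- of_real b - \<i> * of_real \<sigma>)"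
    "contour_integral (horizontal_path b \<tau>) f = F (of_real b - \<i> * of_real \<tau>) - F (- of_real b - \<i> * of_real \<tau>)"
    using prim corners by (auto intro!: contour_integral_unique)
  then have "contour_integral (horizontal_path b \<sigma>) f - contour_integral (horizontal_path b \<tau>) f
     = (F (of_real b - \<i> * of_real \<sigma>) - F (of_real b - \<i> * of_real \<tau>))
       - (F (- of_real b - \<i> * of_real \<sigma>) - F (- of_real b - \<i> * of_real \<tau>))"
    by simp
  then show ?thesis
    using side[of "of_real b"] side[of "- of_real b"] corners
      norm_triangle_ineq4[of "F (of_real b - \<i> * of_real \<sigma>) - F (of_real b - \<i> * of_real \<tau>)"
        "F (- of_real b - \<i> * of_real \<sigma>) - F (- of_real b - \<i> * of_real \<tau>)"]
    by auto
qed

section \<open>Decay of the kernel\<close>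

definition sinh_kernel :: "complex \<Rightarrow> complex" where
  "sinh_kernel x = of_real pi / (2 * sinh (of_real pi * x / 2))"

lemma Re_Im_sinh:
  "Re (sinh z) = sinh (Re z) * cos (Im z)" "Im (sinh z) = cosh (Re z) * sin (Im z)"
  by (simp_all add: sinh_field_def cosh_field_def Re_exp Im_exp algebra_simps)

lemma norm_sinh_ge_sin: "\<bar>sin (Im z)\<bar> * cosh (Re z) \<le> norm (sinh z)"
  using abs_Im_le_cmod[of "sinh z"] by (simp add: Re_Im_sinh abs_mult mult.commute)

lemma norm_sinh_ge_sinh: "\<bar>sinh (Re z)\<bar> \<le> norm (sinh z)" for z :: complex
proof (rule power2_le_imp_le)
  have "(sinh (Re z))\<^sup>2 = (sinh (Re z))\<^sup>2 * (cos (Im z))\<^sup>2 + (sinh (Re z))\<^sup>2 * (sin (Im z))\<^sup>2"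
    by (simp flip: distrib_left)
  also have "\<dots> \<le> (sinh (Re z))\<^sup>2 * (cos (Im z))\<^sup>2 + (cosh (Re z))\<^sup>2 * (sin (Im z))\<^sup>2"
    by (intro add_left_mono mult_right_mono) (simp_all add: cosh_square_eq)
  also have "\<dots> = (norm (sinh z))\<^sup>2"
    unfolding cmod_power2 Re_Im_sinh power_mult_distrib ..
  finally show "\<bar>sinh (Re z)\<bar>\<^sup>2 \<le> (norm (sinh z))\<^sup>2" by simp
qed simp

lemma exp_abs_le_cosh: "exp \<bar>a\<bar> \<le> 2 * cosh (a :: real)"
  by (cases "a \<ge> 0") (simp_all add: cosh_field_def abs_if)

lemma exp_abs_le_sinh: "1 \<le> \<bar>a\<bar> \<Longrightarrow> exp \<bar>a\<bar> \<le> 4 * \<bar>sinh (a :: real)\<bar>"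
proof -
  assume a: "1 \<le> \<bar>a\<bar>"
  have e: "2 \<le> exp \<bar>a\<bar>" using exp_ge_add_one_self[of "\<bar>a\<bar>"] a by linarith
  have "exp (- \<bar>a\<bar>) \<le> 1 / 2" using e by (simp add: exp_minus field_simps)
  then have "exp (- \<bar>a\<bar>) \<le> exp \<bar>a\<bar> / 2" using e by linarith
  moreover have "\<bar>sinh a\<bar> = sinh \<bar>a\<bar>" by simp
  moreover have "sinh \<bar>a\<bar> = (exp \<bar>a\<bar> - exp (- \<bar>a\<bar>)) / 2" by (rule sinh_field_def)
  ultimately show ?thesis by simp
qed

text \<open>Weakens the decay rate pi/2 to 3/2. The excess over 1 later absorbs the polynomial
  growth in u.\<close>

lemma exp_half_pi_le: "exp (3/2 * \<bar>u\<bar>) \<le> exp \<bar>pi * u / 2\<bar>"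
  using pi_gt3 mult_right_mono[of 3 pi "\<bar>u\<bar>"] by (simp add: abs_mult)

text \<open>For a fixed horizontal line: valid up to Re x = 0, but with a constant that blows up as
  the line approaches a pole of the kernel.\<close>

lemma norm_sinh_kernel_le:
  assumes "sin (pi * Im x / 2) \<noteq> 0"
  shows "norm (sinh_kernel x) \<le> pi / \<bar>sin (pi * Im x / 2)\<bar> * exp (- (3/2 * \<bar>Re x\<bar>))"
proof -
  define s where "s = \<bar>sin (pi * Im x / 2)\<bar>"
  have s: "s > 0" using assms by (simp add: s_def)
  have "s * exp (3/2 * \<bar>Re x\<bar>) \<le> s * (2 * cosh (pi * Re x / 2))"
    using order_trans[OF exp_half_pi_le[of "Re x"] exp_abs_le_cosh[of "pi * Re x / 2"]] s
    by (intro mult_left_mono) auto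
  also have "\<dots> \<le> 2 * norm (sinh (of_real pi * x / 2))"
    using norm_sinh_ge_sin[of "of_real pi * x / 2"] by (simp add: s_def)
  finally have le: "s * exp (3/2 * \<bar>Re x\<bar>) \<le> 2 * norm (sinh (of_real pi * x / 2))" .
  have "0 < s * exp (3/2 * \<bar>Re x\<bar>)" using s by simp
  with le have sinh0: "0 < norm (sinh (of_real pi * x / 2))" by linarith
  have "pi / (2 * norm (sinh (of_real pi * x / 2))) \<le> pi / (s * exp (3/2 * \<bar>Re x\<bar>))"
    using s le sinh0 by (intro divide_left_mono) auto
  then show ?thesis by (simp add: sinh_kernel_def norm_divide norm_mult s_def exp_minus field_simps)
qed

text \<open>For the vertical sides, where the constant must be uniform in Im x. Far from Re x = 0
  the real part alone controls sinh.\<close>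

lemma norm_sinh_kernel_le_far:
  assumes "1 \<le> \<bar>Re x\<bar>"
  shows "norm (sinh_kernel x) \<le> 2 * pi * exp (- (3/2 * \<bar>Re x\<bar>))"
proof -
  have "1 \<le> \<bar>pi * Re x / 2\<bar>"
    using pi_gt3 mult_mono[of 2 pi 1 "\<bar>Re x\<bar>"] assms by (simp add: abs_mult)
  then have le: "exp (3/2 * \<bar>Re x\<bar>) \<le> 4 * norm (sinh (of_real pi * x / 2))"
    using order_trans[OF exp_half_pi_le[of "Re x"] exp_abs_le_sinh[of "pi * Re x / 2"]]
      norm_sinh_ge_sinh[of "of_real pi * x / 2"] by simp
  moreover have "0 < exp (3/2 * \<bar>Re x\<bar>)" by simp
  ultimately have "0 < norm (sinh (of_real pi * x / 2))" by linarith
  then have "2 * pi / (4 * norm (sinh (of_real pi * x / 2))) \<le> 2 * pi / exp (3/2 * \<bar>Re x\<bar>)"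
    using le by (intro divide_left_mono) auto
  then show ?thesis by (simp add: sinh_kernel_def norm_divide norm_mult exp_minus field_simps)
qed

lemma sin_half_pi_nonzero:
  assumes "-2 < s" "s < 0"
  shows "sin (pi * s / 2) \<noteq> 0"
proof -
  have "sin (- (pi * s / 2)) > 0"
    using assms mult_strict_left_mono[OF assms(1) pi_gt_zero]
    by (intro sin_gt_zero) (auto simp: mult_less_0_iff field_simps)
  then show ?thesis by simp
qed

section \<open>The two integrands and where they are holomorphic\<close>

definition quad_integrand :: "real \<Rightarrow> complex \<Rightarrow> complex" where
  "quad_integrand t x = exp (\<i> * x * theta_deriv 1 (of_real t) + \<i> * x\<^sup>2 / 2 * theta_deriv 2 (of_real t)) *
     riemann_zeta (1/2 + \<i> * (of_real t + x)) * sinh_kernel x"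

lemma U_integrand_eq: "U_integrand t x = quad_integrand t x * exp (\<i> * theta_rem t x)"
proof -
  have "\<i> * rs_theta (of_real t + x) - \<i> * rs_theta (of_real t)
    = \<i> * x * theta_deriv 1 (of_real t) + \<i> * x\<^sup>2 / 2 * theta_deriv 2 (of_real t) + \<i> * theta_rem t x"
    by (simp add: theta_rem_def algebra_simps)
  then show ?thesis unfolding U_integrand_def quad_integrand_def sinh_kernel_def by (simp add: exp_add)
qed

text \<open>The horizontal edges pass through the kernel poles 0 and -2\<i>. The left edge keeps
  Re(t + x) positive, away from both theta slits and from the zeta pole. All contour shifts take
  place in this convex set.\<close>

definition half_strip :: "real \<Rightarrow> complex set" where
  "half_strip t = {x. - t < Re x} \<inter> {x. - 2 < Im x} \<inter> {x. Im x < 0}"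

lemma open_half_strip: "open (half_strip t)"
  unfolding half_strip_def by (intro open_Int open_halfspace_Re_gt open_halfspace_Im_gt open_halfspace_Im_lt)

lemma convex_half_strip: "convex (half_strip t)"
  unfolding half_strip_def by (intro convex_Int convex_halfspace_Re_gt convex_halfspace_Im_gt convex_halfspace_Im_lt)

lemma sinh_nonzero:
  assumes "-2 < Im x" "Im x < 0"
  shows "sinh (of_real pi * x / 2) \<noteq> 0"
proof -
  have "0 < \<bar>sin (pi * Im x / 2)\<bar> * cosh (pi * Re x / 2)"
    using sin_half_pi_nonzero[OF assms] by simp
  then show ?thesis using norm_sinh_ge_sin[of "of_real pi * x / 2"] by auto
qed

lemma holomorphic_sinh_kernel: "sinh_kernel holomorphic_on {x. -2 < Im x \<and> Im x < 0}"
proof -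
  have eq: "sinh_kernel = (\<lambda>x. of_real pi / (exp (of_real pi * x / 2) - exp (- (of_real pi * x / 2))))"
    by (rule ext) (simp only: sinh_kernel_def sinh_field_def, simp only: times_divide_eq_right nonzero_mult_div_cancel_left[OF zero_neq_numeral[symmetric]])
  have "exp (of_real pi * x / 2) - exp (- (of_real pi * x / 2)) \<noteq> 0"
    if "-2 < Im x" "Im x < 0" for x
    using sinh_nonzero[OF that] by (auto simp: sinh_field_def)
  then show ?thesis unfolding eq by (intro holomorphic_intros) auto
qed

lemma holomorphic_zeta_line:
  assumes "\<And>x. x \<in> S \<Longrightarrow> 1/2 + \<i> * (of_real t + x) \<noteq> 1"
  shows "(\<lambda>x. riemann_zeta (1/2 + \<i> * (of_real t + x))) holomorphic_on S"
proof -
  have "(riemann_zeta \<circ> (\<lambda>x. 1/2 + \<i> * (of_real t + x))) holomorphic_on S"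
    by (rule holomorphic_on_compose_gen[OF _ riemann_zeta_holomorphic])
      (use assms in \<open>auto intro!: holomorphic_intros\<close>)
  then show ?thesis by (simp add: o_def)
qed

lemma holomorphic_quad_integrand: "quad_integrand t holomorphic_on half_strip t"
proof -
  have "(\<lambda>x. riemann_zeta (1/2 + \<i> * (of_real t + x))) holomorphic_on half_strip t"
    by (rule holomorphic_zeta_line) (auto simp: half_strip_def complex_eq_iff)
  moreover have "sinh_kernel holomorphic_on half_strip t"
    by (rule holomorphic_on_subset[OF holomorphic_sinh_kernel]) (auto simp: half_strip_def)
  ultimately show ?thesis
    unfolding quad_integrand_def [abs_def] by (intro holomorphic_intros) auto
qed

text \<open>Stated for a general S because two regions are used: \<open>half_strip\<close> for the
  shifts, and the full strip -1/2 < Im x < 0 for the line defining U, where Re(t + x) may vanish but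
  the height still avoids slits and pole.\<close>

lemma holomorphic_U_integrand:
  assumes "\<And>x. x \<in> S \<Longrightarrow> of_real t + x \<in> theta_dom"
    and "\<And>x. x \<in> S \<Longrightarrow> 1/2 + \<i> * (of_real t + x) \<noteq> 1"
    and "S \<subseteq> {x. -2 < Im x \<and> Im x < 0}"
  shows "U_integrand t holomorphic_on S"
proof -
  have "(rs_theta \<circ> (\<lambda>x. of_real t + x)) holomorphic_on S"
    by (rule holomorphic_on_compose_gen[OF _ rs_theta_holomorphic])
      (use assms(1) in \<open>auto intro!: holomorphic_intros\<close>)
  then have "(\<lambda>x. rs_theta (of_real t + x)) holomorphic_on S" by (simp add: o_def)
  moreover have "sinh_kernel holomorphic_on S"
    by (rule holomorphic_on_subset[OF holomorphic_sinh_kernel assms(3)])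
  ultimately show ?thesis
    unfolding U_integrand_def [abs_def] sinh_kernel_def[symmetric]
    by (intro holomorphic_intros holomorphic_zeta_line assms(2)) auto
qed

lemma holomorphic_U_integrand_half_strip: "U_integrand t holomorphic_on half_strip t"
  by (rule holomorphic_U_integrand) (auto simp: half_strip_def complex_eq_iff intro!: theta_domI)

section \<open>Size of the integrands\<close>

lemma U_integrand_quarter_line_bound:
  "\<exists>K>0. \<forall>t\<ge>1. \<forall>u. norm (U_integrand t (of_real u - \<i> * of_real (1/4))) \<le> K * t\<^sup>2 * exp (- \<bar>u\<bar>)"
proof -
  obtain A where A: "A > 0" "\<And>v. norm (exp (\<i> * rs_theta (of_real v - \<i> / 4))) \<le> A * (1 + \<bar>v\<bar>)"
    using norm_exp_rs_theta_quarter_line by blast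
  obtain Z where Z: "Z > 0" "\<And>s. 1/2 \<le> Re s \<Longrightarrow> 1/4 \<le> norm (s - 1) \<Longrightarrow> norm (riemann_zeta s) \<le> Z * (1 + norm s)"
    using riemann_zeta_bound by blast
  define s where "s = \<bar>sin (pi * (-1/4) / 2)\<bar>"
  have s: "s > 0" using sin_half_pi_nonzero[of "-1/4"] by (simp add: s_def)
  \<comment> \<open>Trades quadratic growth for exp(v/2), the surplus of the decay rate 3/2 over the
    rate 1 in the statement.\<close>
  have sq: "(1 + v)\<^sup>2 \<le> 32 * exp (v / 2)" if "0 \<le> v" for v :: real
  proof -
    have "1 + v \<le> 4 * (1 + v / 4)" by simp
    also have "\<dots> \<le> 4 * exp (v / 4)" by (intro mult_left_mono exp_ge_add_one_self) auto
    finally have "(1 + v)\<^sup>2 \<le> (4 * exp (v / 4))\<^sup>2" using that by (intro power_mono) auto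
    also have "\<dots> = 16 * exp (v / 2)" by (simp add: power_mult_distrib flip: exp_double)
    also have "\<dots> \<le> 32 * exp (v / 2)" by simp
    finally show ?thesis .
  qed
  have "norm (U_integrand t (of_real u - \<i> * of_real (1/4))) \<le> (A * (2 * Z) * (pi / s) * 128) * t\<^sup>2 * exp (- \<bar>u\<bar>)"
    if t: "1 \<le> t" for t u
  proof -
    define x where "x = of_real u - \<i> * of_real (1/4)"
    define w where "w = 1/2 + \<i> * (of_real t + x)"
    have x: "Re x = u" "Im x = -1/4" by (simp_all add: x_def)
    have "norm (exp (\<i> * rs_theta (of_real t + x) - \<i> * rs_theta (of_real t)))
        = norm (exp (\<i> * rs_theta (of_real (t + u) - \<i> / 4)))"
      using Im_rs_theta_of_real[of t] by (simp add: x_def add_diff_eq)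
    also have "\<dots> \<le> A * (1 + \<bar>t + u\<bar>)" by (rule A(2))
    finally have 1: "norm (exp (\<i> * rs_theta (of_real t + x) - \<i> * rs_theta (of_real t))) \<le> A * (1 + t + \<bar>u\<bar>)"
      using A(1) t by (smt (verit) mult_left_mono)
    have w: "w = of_real (3/4) + \<i> * of_real (t + u)" by (simp add: w_def x_def algebra_simps complex_eq_iff)
    have "1/4 \<le> \<bar>Re (w - 1)\<bar>" by (simp add: w)
    then have "1/4 \<le> norm (w - 1)" using abs_Re_le_cmod[of "w - 1"] by linarith
    then have "norm (riemann_zeta w) \<le> Z * (1 + norm w)" by (intro Z(2)) (simp_all add: w)
    also have "norm w \<le> 3/4 + \<bar>t + u\<bar>"
      unfolding w by (rule order_trans[OF norm_triangle_ineq]) (simp add: norm_mult flip: of_real_add)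
    then have "Z * (1 + norm w) \<le> Z * (2 * (1 + t + \<bar>u\<bar>))"
      using t Z(1) by (intro mult_left_mono) auto
    finally have 2: "norm (riemann_zeta w) \<le> 2 * Z * (1 + t + \<bar>u\<bar>)" by (simp only: mult_ac)
    have 3: "norm (sinh_kernel x) \<le> pi / s * exp (- (3/2 * \<bar>u\<bar>))"
      using norm_sinh_kernel_le[of x] s unfolding x by (simp add: s_def)
    have "norm (U_integrand t x) \<le> (A * (1 + t + \<bar>u\<bar>)) * (2 * Z * (1 + t + \<bar>u\<bar>)) * (pi / s * exp (- (3/2 * \<bar>u\<bar>)))"
      unfolding U_integrand_def sinh_kernel_def[symmetric] w_def[symmetric] norm_mult
      using 1 2 3 A(1) Z(1) t s by (intro mult_mono) auto
    also have "\<dots> = (A * (2 * Z) * (pi / s)) * ((1 + t + \<bar>u\<bar>)\<^sup>2 * exp (- (3/2 * \<bar>u\<bar>)))"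
      by (simp add: power2_eq_square)
    also have "\<dots> \<le> (A * (2 * Z) * (pi / s)) * (128 * t\<^sup>2 * exp (- \<bar>u\<bar>))"
    proof (rule mult_left_mono)
      \<comment> \<open>Separates t from u. Theta and zeta each contribute this factor once, hence
        the square of t.\<close>
      have "1 + t + \<bar>u\<bar> \<le> 2 * t * (1 + \<bar>u\<bar>)"
        using t mult_right_mono[of 1 t "\<bar>u\<bar>"] by (simp add: algebra_simps)
      then have "(1 + t + \<bar>u\<bar>)\<^sup>2 \<le> (2 * t * (1 + \<bar>u\<bar>))\<^sup>2" using t by (intro power_mono) auto
      also have "\<dots> = 4 * t\<^sup>2 * (1 + \<bar>u\<bar>)\<^sup>2" by (simp add: power_mult_distrib)
      also have "\<dots> \<le> 4 * t\<^sup>2 * (32 * exp (\<bar>u\<bar> / 2))" by (intro mult_left_mono sq) auto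
      finally have "(1 + t + \<bar>u\<bar>)\<^sup>2 * exp (- (3/2 * \<bar>u\<bar>)) \<le> 4 * t\<^sup>2 * (32 * exp (\<bar>u\<bar> / 2)) * exp (- (3/2 * \<bar>u\<bar>))"
        by (intro mult_right_mono) auto
      also have "\<dots> = 128 * t\<^sup>2 * exp (- \<bar>u\<bar>)" by (simp flip: exp_add)
      finally show "(1 + t + \<bar>u\<bar>)\<^sup>2 * exp (- (3/2 * \<bar>u\<bar>)) \<le> 128 * t\<^sup>2 * exp (- \<bar>u\<bar>)" .
    qed (use A(1) Z(1) s in simp)
    finally show ?thesis by (simp add: x_def mult_ac)
  qed
  then show ?thesis using A(1) Z(1) s by (intro exI[of _ "A * (2 * Z) * (pi / s) * 128"]) auto
qed

text \<open>Both derivatives are real at t, so the linear term contributes to the modulus only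
  through Im x, and the quadratic one only through the product of Re x and Im x.\<close>

lemma Re_theta_quadratic:
  "Re (\<i> * x * theta_deriv 1 (of_real t) + \<i> * x\<^sup>2 / 2 * theta_deriv 2 (of_real t))
    = - Im x * Re (theta_deriv 1 (of_real t)) - Re x * Im x * Re (theta_deriv 2 (of_real t))"
  using Im_theta_deriv_of_real[of t] by (simp add: power2_eq_square algebra_simps)

text \<open>The sharp size of \<open>exp (\<vartheta>' t)\<close> is read off at \<open>x = -\<i>/2\<close>, where the quadratic Taylor term is
  purely imaginary and the reflection formula gives the modulus of \<open>exp (\<i> \<vartheta>(t + x))\<close> in closed form.\<close>
lemma exp_theta_deriv_bound: "\<forall>\<^sub>F t in at_top. exp (2 * Re (theta_deriv 1 (of_real t))) \<le> 3 * t"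
proof -
  \<comment> \<open>The weakest exponent \<eta> = 1 suffices: at the single point x = -\<i>/2 the
    remainder only has to be bounded.\<close>
  obtain B where B: "B > 0" "\<And>t x. 4 \<le> t \<Longrightarrow> norm x \<le> t / 2 \<Longrightarrow> \<bar>Im x\<bar> \<le> 2 \<Longrightarrow>
      norm (theta_rem t x) \<le> B * norm x ^ 3 * t powr (1 - 2)"
    using norm_theta_rem_le[of 1] by auto
  have "\<forall>\<^sub>F t in at_top. max 4 B \<le> (t::real)" by (rule eventually_ge_at_top)
  then show ?thesis
  proof eventually_elim
    case (elim t)
    define x where "x = - (\<i> / 2)"
    define r where "r = Re (theta_deriv 1 (of_real t))"
    define N where "N = norm (exp (\<i> * rs_theta (of_real t - \<i> / 2)))"
    have t: "4 \<le> t" "B \<le> t" using elim by auto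
    have x: "norm x = 1/2" "Re x = 0" "Im x = -1/2" by (simp_all add: x_def norm_divide)
    have "norm (theta_rem t x) \<le> B * (1/2) ^ 3 * t powr (1 - 2)"
      using B(2)[of t x] t unfolding x by simp
    also have "\<dots> = (B / t) / 8" using t by (simp add: powr_minus field_simps)
    also have "\<dots> \<le> 1 / 8" using t by (simp add: field_simps)
    finally have R: "norm (theta_rem t x) \<le> 1/8" .
    have "\<i> * x * theta_deriv 1 (of_real t) + \<i> * x\<^sup>2 / 2 * theta_deriv 2 (of_real t)
        = \<i> * rs_theta (of_real t + x) - \<i> * rs_theta (of_real t) - \<i> * theta_rem t x"
      by (simp add: theta_rem_def algebra_simps)
    then have "Re (\<i> * x * theta_deriv 1 (of_real t) + \<i> * x\<^sup>2 / 2 * theta_deriv 2 (of_real t))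
        = Re (\<i> * rs_theta (of_real t + x)) + Im (theta_rem t x)"
      using Im_rs_theta_of_real[of t] by simp
    then have "r / 2 \<le> Re (\<i> * rs_theta (of_real t + x)) + 1/8"
      using R abs_Im_le_cmod[of "theta_rem t x"] unfolding Re_theta_quadratic x r_def by simp
    then have "exp (r / 2) \<le> exp (Re (\<i> * rs_theta (of_real t + x)) + 1/8)" by simp
    also have "\<dots> = N * exp (1/8)" by (simp only: exp_add) (simp add: N_def x_def)
    \<comment> \<open>The fourth power matches \<open>norm_exp_rs_theta_half_line\<close> and turns
      r/2 into 2r.\<close>
    finally have "exp (r / 2) ^ 4 \<le> (N * exp (1/8)) ^ 4" by (intro power_mono) auto
    also have "\<dots> = N ^ 4 * exp (1/2)" by (simp add: power_mult_distrib flip: exp_of_nat_mult)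
    also have "\<dots> \<le> t * 3"
    proof (rule mult_mono)
      show "N ^ 4 \<le> t" unfolding N_def by (rule norm_exp_rs_theta_half_line) (use t in simp)
      have "exp (1/2 :: real) \<le> exp 1" by simp
      then show "exp (1/2 :: real) \<le> 3" using exp_le by linarith
    qed (use t in auto)
    also have "exp (r / 2) ^ 4 = exp (2 * r)" by (simp flip: exp_of_nat_mult)
    finally show ?case by (simp add: r_def)
  qed
qed

lemma norm_exp_theta_quadratic_le:
  assumes C: "0 < C"
  shows "\<forall>\<^sub>F t in at_top. \<forall>x. \<bar>Re x\<bar> \<le> C * ln t \<longrightarrow> -2 \<le> Im x \<longrightarrow> Im x \<le> 0 \<longrightarrow>
    norm (exp (\<i> * x * theta_deriv 1 (of_real t) + \<i> * x\<^sup>2 / 2 * theta_deriv 2 (of_real t))) \<le> 9 * t powr (- Im x / 2)"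
proof -
  obtain B where B: "B > 0" "\<And>z. 2 \<le> Re z \<Longrightarrow> \<bar>Im z\<bar> \<le> 2 \<Longrightarrow> norm (theta_deriv 2 z) \<le> B * Re z powr (1/2 - 1)"
    using theta_deriv_bounds(1)[of "1/2"] by auto
  \<comment> \<open>The second-derivative term is O(log t / sqrt t), so it costs at most a factor
    e.\<close>
  have "\<forall>\<^sub>F t in at_top. 2 * (C * ln t) * (B * t powr (1/2 - 1)) \<le> 1"
    using B(1) C by real_asymp
  with exp_theta_deriv_bound eventually_ge_at_top[of 2] show ?thesis
  proof (eventually_elim, intro allI impI)
    fix t :: real and x :: complex
    define r1 where "r1 = Re (theta_deriv 1 (of_real t))"
    define r2 where "r2 = Re (theta_deriv 2 (of_real t))"
    define s where "s = - Im x"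
    assume t: "exp (2 * Re (theta_deriv 1 (of_real t))) \<le> 3 * t" "2 \<le> t"
      and small: "2 * (C * ln t) * (B * t powr (1/2 - 1)) \<le> 1"
      and x: "\<bar>Re x\<bar> \<le> C * ln t" "-2 \<le> Im x" "Im x \<le> 0"
    have s: "0 \<le> s" "s \<le> 2" using x by (auto simp: s_def)
    have "\<bar>r2\<bar> \<le> B * t powr (1/2 - 1)"
      using B(2)[of "of_real t"] t abs_Re_le_cmod[of "theta_deriv 2 (of_real t)"] by (simp add: r2_def)
    then have "(s * \<bar>Re x\<bar>) * \<bar>r2\<bar> \<le> (2 * (C * ln t)) * (B * t powr (1/2 - 1))"
      using s x by (intro mult_mono) auto
    with small have "s * \<bar>Re x\<bar> * \<bar>r2\<bar> \<le> 1" by linarith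
    moreover have "Re x * s * r2 \<le> \<bar>Re x * s * r2\<bar>" by simp
    moreover have "\<bar>Re x * s * r2\<bar> = s * \<bar>Re x\<bar> * \<bar>r2\<bar>" using s by (simp add: abs_mult)
    ultimately have 2: "Re x * s * r2 \<le> 1" by linarith
    have "2 * r1 \<le> ln (3 * t)" using t by (subst ln_ge_iff) (auto simp: r1_def)
    then have "s * r1 \<le> s / 2 * ln (3 * t)" using s mult_left_mono[of "2 * r1" "ln (3 * t)" "s / 2"] by simp
    with 2 have "s * r1 + Re x * s * r2 \<le> s / 2 * ln (3 * t) + 1" by linarith
    then have "exp (s * r1 + Re x * s * r2) \<le> exp (s / 2 * ln (3 * t) + 1)" by simp
    also have "\<dots> = (3 * t) powr (s / 2) * exp 1" using t by (simp add: powr_def exp_add)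
    also have "\<dots> = 3 powr (s / 2) * exp 1 * t powr (s / 2)" using t by (simp add: powr_mult)
    \<comment> \<open>One 3 comes from the bound 3t on exp(2 theta'(t)), using s/2 <= 1; the other
      bounds e.\<close>
    also have "\<dots> \<le> 3 powr 1 * 3 * t powr (s / 2)"
      using s exp_le by (intro mult_right_mono mult_mono powr_mono) auto
    finally have "exp (s * r1 + Re x * s * r2) \<le> 9 * t powr (s / 2)" by simp
    then show "norm (exp (\<i> * x * theta_deriv 1 (of_real t) + \<i> * x\<^sup>2 / 2 * theta_deriv 2 (of_real t))) \<le> 9 * t powr (- Im x / 2)"
      unfolding norm_exp_eq_Re Re_theta_quadratic by (simp add: s_def r1_def r2_def)
  qed
qed

text \<open>The pointwise estimate is used with \<eta>/2, and the other half of \<eta> absorbs the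
  cube of log t. The bound by 1 is what allows exp(\<i>R) to be estimated by constants.\<close>

lemma theta_rem_eventually_le:
  assumes C: "0 < C" and \<eta>: "0 < \<eta>" "\<eta> \<le> 1"
  shows "\<forall>\<^sub>F t in at_top. \<forall>x. \<bar>Re x\<bar> \<le> C * ln t \<longrightarrow> \<bar>Im x\<bar> \<le> 2 \<longrightarrow>
    norm (theta_rem t x) \<le> t powr (\<eta> - 2) \<and> norm (theta_rem t x) \<le> 1"
proof -
  obtain B where B: "B > 0" "\<And>t x. 4 \<le> t \<Longrightarrow> norm x \<le> t / 2 \<Longrightarrow> \<bar>Im x\<bar> \<le> 2 \<Longrightarrow>
      norm (theta_rem t x) \<le> B * norm x ^ 3 * t powr (\<eta> / 2 - 2)"
    using norm_theta_rem_le[of "\<eta> / 2"] \<eta> by auto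
  have "\<forall>\<^sub>F t in at_top. C * ln t + 2 \<le> t / 2" using C by real_asymp
  moreover have "\<forall>\<^sub>F t in at_top. B * (C * ln t + 2) ^ 3 \<le> t powr (\<eta> / 2)" using C B(1) \<eta> by real_asymp
  moreover have "\<forall>\<^sub>F t in at_top. (4::real) \<le> t" by (rule eventually_ge_at_top)
  ultimately show ?thesis
  proof (eventually_elim, intro allI impI)
    fix t :: real and x :: complex
    assume t: "C * ln t + 2 \<le> t / 2" "B * (C * ln t + 2) ^ 3 \<le> t powr (\<eta> / 2)" "4 \<le> t"
      and x: "\<bar>Re x\<bar> \<le> C * ln t" "\<bar>Im x\<bar> \<le> 2"
    have nx: "norm x \<le> C * ln t + 2" using cmod_le[of x] x by linarith
    then have "norm (theta_rem t x) \<le> B * norm x ^ 3 * t powr (\<eta> / 2 - 2)"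
      using t x by (intro B(2)) auto
    also have "B * norm x ^ 3 \<le> B * (C * ln t + 2) ^ 3"
      using nx B(1) by (intro mult_left_mono power_mono) auto
    then have "B * norm x ^ 3 * t powr (\<eta> / 2 - 2) \<le> t powr (\<eta> / 2) * t powr (\<eta> / 2 - 2)"
      using t by (intro mult_right_mono) auto
    also have "\<dots> = t powr (\<eta> - 2)" by (simp flip: powr_add)
    finally have "norm (theta_rem t x) \<le> t powr (\<eta> - 2)" .
    moreover have "t powr (\<eta> - 2) \<le> t powr 0" using t \<eta> by (intro powr_mono) auto
    ultimately show "norm (theta_rem t x) \<le> t powr (\<eta> - 2) \<and> norm (theta_rem t x) \<le> 1" using t by simp
  qed
qed

text \<open>One power of t comes from the exponential, since -Im x / 2 <= 1, and one from the linear
  bound on zeta. The constant does not depend on the height, as a shift requires.\<close>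

lemma quad_integrand_side_bound:
  assumes C: "0 < C"
  shows "\<exists>K>0. \<forall>\<^sub>F t in at_top. \<forall>x\<in>half_strip t. \<bar>Re x\<bar> = C * ln t \<longrightarrow>
    norm (quad_integrand t x) \<le> K * t\<^sup>2 * exp (- (C * ln t))"
proof -
  obtain Z where Z: "Z > 0" "\<And>s. 1/2 \<le> Re s \<Longrightarrow> 1/4 \<le> norm (s - 1) \<Longrightarrow> norm (riemann_zeta s) \<le> Z * (1 + norm s)"
    using riemann_zeta_bound by blast
  have "\<forall>\<^sub>F t in at_top. C * ln t \<le> t / 2" using C by real_asymp
  moreover have "\<forall>\<^sub>F t in at_top. 1 \<le> C * ln t" using C by real_asymp
  moreover have "\<forall>\<^sub>F t in at_top. (4::real) \<le> t" by (rule eventually_ge_at_top)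
  ultimately have "\<forall>\<^sub>F t in at_top. \<forall>x\<in>half_strip t. \<bar>Re x\<bar> = C * ln t \<longrightarrow>
    norm (quad_integrand t x) \<le> (9 * (Z * 4) * (2 * pi)) * t\<^sup>2 * exp (- (C * ln t))"
    using norm_exp_theta_quadratic_le[OF C]
  proof (eventually_elim, intro ballI impI)
    fix t :: real and x :: complex
    define w where "w = 1/2 + \<i> * (of_real t + x)"
    define E where "E = exp (\<i> * x * theta_deriv 1 (of_real t) + \<i> * x\<^sup>2 / 2 * theta_deriv 2 (of_real t))"
    assume t: "C * ln t \<le> t / 2" "1 \<le> C * ln t" "4 \<le> t"
      and E: "\<forall>x. \<bar>Re x\<bar> \<le> C * ln t \<longrightarrow> -2 \<le> Im x \<longrightarrow> Im x \<le> 0 \<longrightarrow>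
        norm (exp (\<i> * x * theta_deriv 1 (of_real t) + \<i> * x\<^sup>2 / 2 * theta_deriv 2 (of_real t))) \<le> 9 * t powr (- Im x / 2)"
      and x: "x \<in> half_strip t" "\<bar>Re x\<bar> = C * ln t"
    have ix: "-2 \<le> Im x" "Im x \<le> 0" using x by (auto simp: half_strip_def)
    have "norm E \<le> 9 * t powr (- Im x / 2)" unfolding E_def using E x ix by simp
    also have "\<dots> \<le> 9 * t powr 1" using ix t by (intro mult_left_mono powr_mono) auto
    finally have 1: "norm E \<le> 9 * t" using t by simp
    have w: "Re w = 1/2 - Im x" "Im w = t + Re x" by (simp_all add: w_def)
    have "t - \<bar>Re x\<bar> \<le> \<bar>Im (w - 1)\<bar>" using t x by (simp add: w)
    then have "1/4 \<le> norm (w - 1)" using abs_Im_le_cmod[of "w - 1"] t x by linarith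
    then have "norm (riemann_zeta w) \<le> Z * (1 + norm w)" using ix by (intro Z(2)) (simp_all add: w)
    also have "norm w \<le> 5/2 + (t + \<bar>Re x\<bar>)" using cmod_le[of w] ix t unfolding w by linarith
    then have "Z * (1 + norm w) \<le> Z * (4 * t)" using t x Z(1) by (intro mult_left_mono) auto
    finally have 2: "norm (riemann_zeta w) \<le> Z * 4 * t" by simp
    have "norm (sinh_kernel x) \<le> 2 * pi * exp (- (3/2 * \<bar>Re x\<bar>))"
      by (rule norm_sinh_kernel_le_far) (use t x in simp)
    also have "\<dots> \<le> 2 * pi * exp (- (C * ln t))" using x t by (intro mult_left_mono) auto
    finally have 3: "norm (sinh_kernel x) \<le> 2 * pi * exp (- (C * ln t))" .
    have "norm (quad_integrand t x) = norm E * norm (riemann_zeta w) * norm (sinh_kernel x)"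
      unfolding quad_integrand_def w_def E_def norm_mult ..
    also have "\<dots> \<le> (9 * t) * (Z * 4 * t) * (2 * pi * exp (- (C * ln t)))"
      using 1 2 3 t Z(1) by (intro mult_mono) auto
    finally show "norm (quad_integrand t x) \<le> (9 * (Z * 4) * (2 * pi)) * t\<^sup>2 * exp (- (C * ln t))"
      by (simp add: power2_eq_square mult_ac)
  qed
  then show ?thesis using Z(1) by (intro exI[of _ "9 * (Z * 4) * (2 * pi)"]) auto
qed

text \<open>The argument of zeta has real part 1/2 + \<sigma> > 1, so the Dirichlet series bounds it
  independently of t, and t^(\<sigma>/2) is the entire growth.\<close>

lemma quad_integrand_line_bound:
  assumes C: "0 < C" and \<sigma>: "1/2 < \<sigma>" "\<sigma> < 2"
  shows "\<exists>K>0. \<forall>\<^sub>F t in at_top. \<forall>x. \<bar>Re x\<bar> \<le> C * ln t \<longrightarrow> Im x = - \<sigma> \<longrightarrow>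
    norm (quad_integrand t x) \<le> K * t powr (\<sigma> / 2)"
proof -
  obtain Z where Z: "Z > 0" "\<And>s. 1/2 + \<sigma> \<le> Re s \<Longrightarrow> norm (riemann_zeta s) \<le> Z"
    using riemann_zeta_bounded_right[of "1/2 + \<sigma>"] \<sigma> by auto
  define s where "s = \<bar>sin (pi * (- \<sigma>) / 2)\<bar>"
  have s: "s > 0" using sin_half_pi_nonzero[of "- \<sigma>"] \<sigma> by (simp add: s_def)
  have "\<forall>\<^sub>F t in at_top. \<forall>x. \<bar>Re x\<bar> \<le> C * ln t \<longrightarrow> Im x = - \<sigma> \<longrightarrow>
    norm (quad_integrand t x) \<le> (9 * Z * (pi / s)) * t powr (\<sigma> / 2)"
    using norm_exp_theta_quadratic_le[OF C]
  proof (eventually_elim, intro allI impI)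
    fix t :: real and x :: complex
    define w where "w = 1/2 + \<i> * (of_real t + x)"
    define E where "E = exp (\<i> * x * theta_deriv 1 (of_real t) + \<i> * x\<^sup>2 / 2 * theta_deriv 2 (of_real t))"
    assume E: "\<forall>x. \<bar>Re x\<bar> \<le> C * ln t \<longrightarrow> -2 \<le> Im x \<longrightarrow> Im x \<le> 0 \<longrightarrow>
        norm (exp (\<i> * x * theta_deriv 1 (of_real t) + \<i> * x\<^sup>2 / 2 * theta_deriv 2 (of_real t))) \<le> 9 * t powr (- Im x / 2)"
      and x: "\<bar>Re x\<bar> \<le> C * ln t" "Im x = - \<sigma>"
    have 1: "norm E \<le> 9 * t powr (\<sigma> / 2)" unfolding E_def using E[rule_format, of x] x \<sigma> by simp
    have 2: "norm (riemann_zeta w) \<le> Z" by (rule Z(2)) (simp add: w_def x)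
    have "norm (sinh_kernel x) \<le> pi / s * exp (- (3/2 * \<bar>Re x\<bar>))"
      using norm_sinh_kernel_le[of x] s unfolding x by (simp add: s_def)
    also have "\<dots> \<le> pi / s * 1" using s by (intro mult_left_mono) auto
    finally have 3: "norm (sinh_kernel x) \<le> pi / s" by simp
    have "norm (quad_integrand t x) = norm E * norm (riemann_zeta w) * norm (sinh_kernel x)"
      unfolding quad_integrand_def w_def E_def norm_mult ..
    also have "\<dots> \<le> (9 * t powr (\<sigma> / 2)) * Z * (pi / s)"
      using 1 2 3 Z(1) by (intro mult_mono) auto
    finally show "norm (quad_integrand t x) \<le> (9 * Z * (pi / s)) * t powr (\<sigma> / 2)"
      by (simp add: mult_ac)
  qed
  then show ?thesis using Z(1) s by (intro exI[of _ "9 * Z * (pi / s)"]) auto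
qed

lemma norm_exp_diff_one_le:
  fixes z :: complex
  assumes "norm z \<le> 1"
  shows "norm (exp z - 1) \<le> 3 * norm z"
proof -
  have "norm (exp z - 1) \<le> exp \<bar>Re z\<bar> * norm z" using Taylor_exp[of z 0] by simp
  also have "\<bar>Re z\<bar> \<le> 1" using assms abs_Re_le_cmod[of z] by linarith
  then have "exp \<bar>Re z\<bar> \<le> 3" using exp_le by (meson exp_le_cancel_iff order_trans)
  then have "exp \<bar>Re z\<bar> * norm z \<le> 3 * norm z" by (intro mult_right_mono) auto
  finally show ?thesis .
qed

lemma continuous_U_integrand_quarter_line:
  "continuous_on UNIV (\<lambda>u. U_integrand t (of_real u - \<i> * of_real (1/4)))"
proof -
  have "U_integrand t holomorphic_on {x. -1/2 < Im x \<and> Im x < 0}"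
    by (rule holomorphic_U_integrand) (auto simp: complex_eq_iff intro!: theta_domI)
  then have "continuous_on {x. -1/2 < Im x \<and> Im x < 0} (U_integrand t)"
    by (rule holomorphic_on_imp_continuous_on)
  then show ?thesis
    by (rule continuous_on_compose2) (auto intro!: continuous_intros)
qed

lemma U_integrand_diff_contour_bound:
  assumes b: "0 < b" "b < t" and \<sigma>: "0 < \<sigma>" "\<sigma> < 2" and A: "0 \<le> A" and D: "D \<le> 1"
    and bnd: "\<And>x. \<bar>Re x\<bar> \<le> b \<Longrightarrow> Im x = - \<sigma> \<Longrightarrow> norm (quad_integrand t x) \<le> A \<and> norm (theta_rem t x) \<le> D"
  shows "norm (contour_integral (horizontal_path b \<sigma>) (U_integrand t)
    - contour_integral (horizontal_path b \<sigma>) (quad_integrand t)) \<le> A * (3 * D) * (2 * b)"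
proof -
  have seg: "\<bar>Re x\<bar> \<le> b \<and> Im x = - \<sigma>"
    if "x \<in> closed_segment (- of_real b - \<i> * of_real \<sigma>) (of_real b - \<i> * of_real \<sigma>)" for x
    using that b by (auto simp: closed_segment_same_Im closed_segment_eq_real_ivl)
  have sub: "closed_segment (- of_real b - \<i> * of_real \<sigma>) (of_real b - \<i> * of_real \<sigma>) \<subseteq> half_strip t"
    using seg b \<sigma> by (force simp: half_strip_def)
  have "U_integrand t contour_integrable_on (horizontal_path b \<sigma>)"
    "quad_integrand t contour_integrable_on (horizontal_path b \<sigma>)"
    by (intro contour_integrable_continuous_linepath continuous_on_subset[OF _ sub]
        holomorphic_on_imp_continuous_on holomorphic_U_integrand_half_strip holomorphic_quad_integrand)+
  then have "((\<lambda>x. U_integrand t x - quad_integrand t x) has_contour_integral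
      (contour_integral (horizontal_path b \<sigma>) (U_integrand t) - contour_integral (horizontal_path b \<sigma>) (quad_integrand t)))
      (horizontal_path b \<sigma>)"
    by (intro has_contour_integral_diff has_contour_integral_integral)
  \<comment> \<open>The midpoint of the segment serves only to extract D >= 0 from the
    bound.\<close>
  moreover have "norm (theta_rem t (- \<i> * of_real \<sigma>)) \<le> D" using bnd[of "- \<i> * of_real \<sigma>"] b by simp
  then have D0: "0 \<le> D" using order_trans[OF norm_ge_zero] by blast
  then have "0 \<le> A * (3 * D)" using A by simp
  moreover have "norm (U_integrand t x - quad_integrand t x) \<le> A * (3 * D)"
    if x: "x \<in> closed_segment (- of_real b - \<i> * of_real \<sigma>) (of_real b - \<i> * of_real \<sigma>)" for x
  proof -
    have q: "norm (quad_integrand t x) \<le> A" "norm (theta_rem t x) \<le> D"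
      using bnd seg[OF x] by blast+
    have "U_integrand t x - quad_integrand t x = quad_integrand t x * (exp (\<i> * theta_rem t x) - 1)"
      by (simp add: U_integrand_eq algebra_simps)
    moreover have "norm (exp (\<i> * theta_rem t x) - 1) \<le> 3 * D"
      using norm_exp_diff_one_le[of "\<i> * theta_rem t x"] q(2) D by (simp add: norm_mult)
    ultimately show ?thesis using q(1) A by (simp only: norm_mult) (intro mult_mono, auto)
  qed
  ultimately have "norm (contour_integral (horizontal_path b \<sigma>) (U_integrand t) - contour_integral (horizontal_path b \<sigma>) (quad_integrand t))
     \<le> A * (3 * D) * norm (of_real b - \<i> * of_real \<sigma> - (- of_real b - \<i> * of_real \<sigma>))"
    by (rule has_contour_integral_bound_linepath)
  also have "of_real b - \<i> * of_real \<sigma> - (- of_real b - \<i> * of_real \<sigma>) = of_real (2 * b)" by simp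
  also have "norm (of_real (2 * b) :: complex) = 2 * b" using b by simp
  finally show ?thesis .
qed

section \<open>Assembly of the error terms\<close>

theorem mainTheorem4:
  fixes \<epsilon> \<sigma>\<^sub>0 :: real
  assumes "0 < \<epsilon>" "\<epsilon> < 1" "0 < \<sigma>\<^sub>0" "\<sigma>\<^sub>0 < 2"
  shows "\<exists>C\<^sub>0>0. \<forall>C\<ge>C\<^sub>0.
    (\<lambda>t::real. U t - (1 / (2 * of_real pi * \<i>)) *
       contour_integral
         (linepath (- of_real (C * ln t) - \<i> * of_real \<sigma>\<^sub>0) (of_real (C * ln t) - \<i> * of_real \<sigma>\<^sub>0))
         (\<lambda>x. exp (\<i> * x * deriv rs_theta (of_real t)
                   + \<i> * x\<^sup>2 / 2 * deriv (deriv rs_theta) (of_real t)) *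
              riemann_zeta (1/2 + \<i> * (of_real t + x)) *
              (of_real pi / (2 * sinh (of_real pi * x / 2)))))
    \<in> O[at_top](\<lambda>t. of_real (t powr (- 7/4 + \<epsilon>)))"
proof (intro exI[of _ 4] conjI allI impI)
  fix C :: real
  \<comment> \<open>The exponentially small errors have size t^(2-C), which for C >= 4 is at most
    t^(-2), below the target for every \<epsilon> > 0.\<close>
  assume C4: "4 \<le> C"
  then have C: "0 < C" by simp
  define \<sigma> where "\<sigma> = 1/2 + \<epsilon> / 2"
  have \<sigma>: "1/2 < \<sigma>" "\<sigma> < 2" "0 < \<sigma>" using assms by (auto simp: \<sigma>_def)
  have quad: "(\<lambda>x. exp (\<i> * x * deriv rs_theta (of_real t) + \<i> * x\<^sup>2 / 2 * deriv (deriv rs_theta) (of_real t)) *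
      riemann_zeta (1/2 + \<i> * (of_real t + x)) * (of_real pi / (2 * sinh (of_real pi * x / 2)))) = quad_integrand t" for t
    unfolding deriv_rs_theta[OF of_real_in_theta_dom] deriv_deriv_rs_theta[OF of_real_in_theta_dom]
      quad_integrand_def [abs_def] sinh_kernel_def ..
  obtain K1 where K1: "K1 > 0"
      "\<And>t u. 1 \<le> t \<Longrightarrow> norm (U_integrand t (of_real u - \<i> * of_real (1/4))) \<le> K1 * t\<^sup>2 * exp (- \<bar>u\<bar>)"
    using U_integrand_quarter_line_bound by blast
  obtain K2 where K2: "K2 > 0" "\<forall>\<^sub>F t in at_top. \<forall>x\<in>half_strip t. \<bar>Re x\<bar> = C * ln t \<longrightarrow>
      norm (quad_integrand t x) \<le> K2 * t\<^sup>2 * exp (- (C * ln t))"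
    using quad_integrand_side_bound[OF C] by blast
  obtain K3 where K3: "K3 > 0" "\<forall>\<^sub>F t in at_top. \<forall>x. \<bar>Re x\<bar> \<le> C * ln t \<longrightarrow> Im x = - \<sigma> \<longrightarrow>
      norm (quad_integrand t x) \<le> K3 * t powr (\<sigma> / 2)"
    using quad_integrand_line_bound[OF C \<sigma>(1,2)] by blast
  have rem: "\<forall>\<^sub>F t in at_top. \<forall>x. \<bar>Re x\<bar> \<le> C * ln t \<longrightarrow> \<bar>Im x\<bar> \<le> 2 \<longrightarrow>
      norm (theta_rem t x) \<le> t powr (\<epsilon> / 4 - 2) \<and> norm (theta_rem t x) \<le> 1"
    using theta_rem_eventually_le[OF C, of "\<epsilon> / 4"] assms by simp
  have ev1: "\<forall>\<^sub>F t in at_top. C * ln t < t" using C by real_asymp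
  have ev2: "\<forall>\<^sub>F t in at_top. C * ln t \<le> t powr (\<epsilon> / 2)" using C assms(1) by real_asymp
  have ev3: "\<forall>\<^sub>F t in at_top. (2::real) \<le> t" by (rule eventually_ge_at_top)
  show "(\<lambda>t::real. U t - (1 / (2 * of_real pi * \<i>)) *
       contour_integral
         (linepath (- of_real (C * ln t) - \<i> * of_real \<sigma>\<^sub>0) (of_real (C * ln t) - \<i> * of_real \<sigma>\<^sub>0))
         (\<lambda>x. exp (\<i> * x * deriv rs_theta (of_real t)
                   + \<i> * x\<^sup>2 / 2 * deriv (deriv rs_theta) (of_real t)) *
              riemann_zeta (1/2 + \<i> * (of_real t + x)) *
              (of_real pi / (2 * sinh (of_real pi * x / 2)))))
    \<in> O[at_top](\<lambda>t. of_real (t powr (- 7/4 + \<epsilon>)))"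
    unfolding quad
  proof (rule bigoI)
    show "\<forall>\<^sub>F t in at_top. norm (U t - (1 / (2 * of_real pi * \<i>)) * contour_integral (horizontal_path (C * ln t) \<sigma>\<^sub>0) (quad_integrand t))
      \<le> (2 * K1 + 16 * K2 + 6 * K3) * norm (complex_of_real (t powr (- 7/4 + \<epsilon>)))"
      using K2(2) K3(2) rem ev1 ev2 ev3
    proof eventually_elim
      case (elim t)
      define b where "b = C * ln t"
      define T where "T = t powr (- 7/4 + \<epsilon>)"
      define IU where "IU = (\<lambda>\<sigma>. contour_integral (horizontal_path b \<sigma>) (U_integrand t))"
      define IQ where "IQ = (\<lambda>\<sigma>. contour_integral (horizontal_path b \<sigma>) (quad_integrand t))"
      note side = elim(1)[folded b_def] and line = elim(2)[folded b_def] and rem = elim(3)[folded b_def]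
      have t: "2 \<le> t" using elim by simp
      have b: "0 < b" "b < t" "b \<le> t powr (\<epsilon> / 2)" using elim C by (auto simp: b_def)
      have small: "t\<^sup>2 * exp (- b) \<le> T"
      proof -
        have "t\<^sup>2 * exp (- b) = t powr (2 - C)"
          using t by (simp add: b_def powr_diff powr_def[of t C] exp_minus field_simps)
        also have "\<dots> \<le> T" unfolding T_def using t C4 assms(1) by (intro powr_mono) auto
        finally show ?thesis .
      qed
      have in_strip: "of_real b - \<i> * of_real \<tau> \<in> half_strip t" "- of_real b - \<i> * of_real \<tau> \<in> half_strip t"
        if "0 < \<tau>" "\<tau> < 2" for \<tau>
        using that b t by (auto simp: half_strip_def)
      have sideQ: "norm (quad_integrand t x) \<le> K2 * T" if "x \<in> half_strip t" "\<bar>Re x\<bar> = \<bar>b\<bar>" for x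
      proof -
        have "norm (quad_integrand t x) \<le> K2 * (t\<^sup>2 * exp (- b))" using side that b by (simp add: mult.assoc)
        also have "\<dots> \<le> K2 * T" using small K2(1) by (intro mult_left_mono) auto
        finally show ?thesis .
      qed
      \<comment> \<open>The original integrand inherits the side bound of the quadratic one, since
        |exp(\<i>R)| <= e <= 3 when |R| <= 1.\<close>
      have sideU: "norm (U_integrand t x) \<le> 3 * (K2 * T)" if x: "x \<in> half_strip t" "\<bar>Re x\<bar> = \<bar>b\<bar>" for x
      proof -
        have "norm (theta_rem t x) \<le> 1" using rem x b by (auto simp: half_strip_def)
        then have "- Im (theta_rem t x) \<le> 1" using abs_Im_le_cmod[of "theta_rem t x"] by linarith
        then have "exp (- Im (theta_rem t x)) \<le> 3" using exp_le by (meson exp_le_cancel_iff order_trans)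
        then have "norm (quad_integrand t x) * norm (exp (\<i> * theta_rem t x)) \<le> (K2 * T) * 3"
          using sideQ[OF x] K2(1) by (intro mult_mono) (auto simp: T_def)
        then show ?thesis by (simp only: U_integrand_eq norm_mult mult_ac)
      qed
      have KT: "0 \<le> K2 * T" using K2(1) by (simp add: T_def)
      have e1: "norm (integral UNIV (\<lambda>u. U_integrand t (of_real u - \<i> * of_real (1/4))) - IU (1/4)) \<le> 2 * (K1 * T)"
      proof -
        have "norm (integral UNIV (\<lambda>u. U_integrand t (of_real u - \<i> * of_real (1/4))) - IU (1/4)) \<le> 2 * (K1 * t\<^sup>2) * exp (- b)"
          unfolding IU_def contour_integral_horizontal_path[OF b(1)]
          by (rule exponential_tail_integral_bound[OF continuous_U_integrand_quarter_line K1(2)]) (use t b in auto)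
        also have "\<dots> = 2 * (K1 * (t\<^sup>2 * exp (- b)))" by simp
        also have "\<dots> \<le> 2 * (K1 * T)" using small K1(1) by (intro mult_left_mono) auto
        finally show ?thesis .
      qed
      have e2: "norm (IU (1/4) - IU \<sigma>) \<le> 12 * (K2 * T)"
      proof -
        have "norm (IU (1/4) - IU \<sigma>) \<le> 2 * (3 * (K2 * T)) * \<bar>1/4 - \<sigma>\<bar>"
          unfolding IU_def
          by (rule horizontal_path_shift_bound[OF holomorphic_U_integrand_half_strip open_half_strip convex_half_strip])
            (use in_strip[of "1/4"] in_strip[of \<sigma>] \<sigma> sideU KT in auto)
        also have "\<dots> \<le> 2 * (3 * (K2 * T)) * 2" using KT \<sigma> by (intro mult_left_mono) auto
        finally show ?thesis by simp
      qed
      have e3: "norm (IU \<sigma> - IQ \<sigma>) \<le> 6 * (K3 * T)"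
      proof -
        have "norm (IU \<sigma> - IQ \<sigma>) \<le> K3 * t powr (\<sigma> / 2) * (3 * t powr (\<epsilon> / 4 - 2)) * (2 * b)"
          unfolding IU_def IQ_def
        proof (rule U_integrand_diff_contour_bound)
          have "t powr (\<epsilon> / 4 - 2) \<le> t powr 0" using t assms(2) by (intro powr_mono) auto
          then show "t powr (\<epsilon> / 4 - 2) \<le> 1" using t by simp
        qed (use b \<sigma> K3(1) line rem in auto)
        also have "\<dots> \<le> K3 * t powr (\<sigma> / 2) * (3 * t powr (\<epsilon> / 4 - 2)) * (2 * t powr (\<epsilon> / 2))"
          using b K3(1) by (intro mult_left_mono) auto
        also have "\<dots> = 6 * (K3 * (t powr (\<sigma> / 2) * t powr (\<epsilon> / 4 - 2) * t powr (\<epsilon> / 2)))" by simp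
        \<comment> \<open>The exponents add up exactly: 1/4 + \<epsilon>/4 from \<sigma>/2, then
          \<epsilon>/4 - 2 from the remainder and \<epsilon>/2 from the length of the path.\<close>
        also have "t powr (\<sigma> / 2) * t powr (\<epsilon> / 4 - 2) * t powr (\<epsilon> / 2) = T"
          unfolding T_def powr_add[symmetric] by (rule arg_cong) (simp add: \<sigma>_def field_simps)
        finally show ?thesis .
      qed
      have e4: "norm (IQ \<sigma> - IQ \<sigma>\<^sub>0) \<le> 4 * (K2 * T)"
      proof -
        have "norm (IQ \<sigma> - IQ \<sigma>\<^sub>0) \<le> 2 * (K2 * T) * \<bar>\<sigma> - \<sigma>\<^sub>0\<bar>"
          unfolding IQ_def
          by (rule horizontal_path_shift_bound[OF holomorphic_quad_integrand open_half_strip convex_half_strip])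
            (use in_strip \<sigma> assms sideQ KT in auto)
        also have "\<dots> \<le> 2 * (K2 * T) * 2" using KT \<sigma> assms by (intro mult_left_mono) auto
        finally show ?thesis by simp
      qed
      define J where "J = integral UNIV (\<lambda>u. U_integrand t (of_real u - \<i> * of_real (1/4)))"
      have "J - IQ \<sigma>\<^sub>0 = (J - IU (1/4)) + (IU (1/4) - IU \<sigma>) + (IU \<sigma> - IQ \<sigma>) + (IQ \<sigma> - IQ \<sigma>\<^sub>0)" by simp
      also have "norm \<dots> \<le> norm (J - IU (1/4)) + norm (IU (1/4) - IU \<sigma>) + norm (IU \<sigma> - IQ \<sigma>) + norm (IQ \<sigma> - IQ \<sigma>\<^sub>0)"
        by (intro norm_triangle_le add_mono) (auto intro: norm_triangle_ineq)
      also have "\<dots> \<le> (2 * K1 + 16 * K2 + 6 * K3) * T"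
        using e1[folded J_def] e2 e3 e4 by (simp add: algebra_simps)
      finally have total: "norm (J - IQ \<sigma>\<^sub>0) \<le> (2 * K1 + 16 * K2 + 6 * K3) * T" .
      have "U t - (1 / (2 * of_real pi * \<i>)) * IQ \<sigma>\<^sub>0 = (1 / (2 * of_real pi * \<i>)) * (J - IQ \<sigma>\<^sub>0)"
        by (simp add: U_def J_def right_diff_distrib)
      then have "norm (U t - (1 / (2 * of_real pi * \<i>)) * IQ \<sigma>\<^sub>0) = norm (J - IQ \<sigma>\<^sub>0) / (2 * pi)"
        by (simp add: norm_mult norm_divide)
      also have "\<dots> \<le> norm (J - IQ \<sigma>\<^sub>0) / 1" using pi_gt3 by (intro divide_left_mono) auto
      also have "\<dots> \<le> (2 * K1 + 16 * K2 + 6 * K3) * norm (complex_of_real T)"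
        using total by (simp add: T_def)
      finally show ?case unfolding IQ_def b_def T_def .
    qed
  qed
qed simp

end
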